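(* If $\mathcal S^\star\subseteq\mathcal S$, in particular if $\mathcal S$ satisfies the weak left cancellation condition, then $\mathsf{Par}(\mathcal C,\mathcal S)$ is a localization of $\mathsf{Sect}(\mathcal C,\mathcal S)$: $$\mathsf{Par}(\mathcal C,\mathcal S)\cong\mathsf{Sect}(\mathcal C,\mathcal S)[\Phi_{\mathrm a}(\mathcal S^\star)^{-1}].$$ Under the same hypothesis, $\mathsf{Retr}(\mathcal C,\mathcal S)$ is also a quotient category of $\mathsf{Sect}(\mathcal C,\mathcal S)$, and $$\mathsf{Retr}(\mathcal C,\mathcal S)\cong\mathcal C[\mathcal S^{-1}].$$
   Context: Standing assumptions: $\mathcal C$ is a category and $\mathcal S$ is a class of morphisms of $\mathcal C$ that contains all isomorphisms, is closed under composition, and is such that pullbacks of $\mathcal S$-morphisms along arbitrary morphisms exist in $\mathcal C$ and belong to $\mathcal S$. The weak left cancellation condition: $s\in\mathcal S$ and $s\cdot t\in\mathcal S$ imply $t\in\mathcal S$. For a category $\mathcal X$ and a class $\Sigma$ of its morphisms, $\mathcal X[\Sigma^{-1}]$ is the category of fractions: it comes with a functor $\mathcal X\to\mathcal X[\Sigma^{-1}]$ mapping $\Sigma$ to isomorphisms, through which every functor on $\mathcal X$ mapping $\Sigma$ to isomorphisms factors uniquely. A quotient category of $\mathcal X$ is a category $\mathcal X/\!\sim$ for a congruence $\sim$ on $\mathcal X$. $\mathcal S$-spans: an $\mathcal S$-span $(s,f):A\to B$ is a pair $s:D\to A$ in $\mathcal S$, $f:D\to B$ in $\mathcal C$. A (vertical)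 morphism $x:(s,f)\to(\tilde s,\tilde f)$ is a $\mathcal C$-morphism with $\tilde s\cdot x=s$, $\tilde f\cdot x=f$. Isomorphic $\mathcal S$-spans are identified. $\mathsf{Span}(\mathcal C,\mathcal S)$ is the category with the objects of $\mathcal C$ and (isomorphism classes of) $\mathcal S$-spans as morphisms, with (horizontal) composition $(t,g)\cdot(s,f)=(s\cdot t',g\cdot f')$, where $f\cdot t'=t\cdot f'$ is a pullback square. A relation for $\mathcal S$-spans is compatible if it relates only $\mathcal S$-spans with the same domain and codomain, relates vertically isomorphic $\mathcal S$-spans, and is preserved by horizontal composition from either side. $\mathcal S$-cospans: an $\mathcal S$-cospan $\langle f,s\rangle:A\to B$ is (the isomorphism class of) a pair $f:A\to D$ in $\mathcal C$, $s:B\to D$ in $\mathcal S$. A morphism $v:\langle f,s\rangle\to\langle g,t\rangle$ is a $\mathcal C$-morphism with $v\cdot f=g$, $v\cdot s=t$; write $\langle f,s\rangle\preceq\langle g,t\rangle$ if there is such $v$ in $\mathcal S$. $\mathrm{pb}\langle f,s\rangle:=(s',f')$ is the $\mathcal S$-span given by the pullback square $f\cdot s'=s\cdot f'$. The conjugate of $v:\langle f,s\rangle\to\langle g,t\rangle$ is the unique morphism $v^\star$ with $t'\cdot v^\star=s'$, $g'\cdot v^\star=f'$, where $(s',f')=\mathrm{pb}\langle f,s\rangle$, $(t',g')=\mathrm{pb}\langle g,t\rangle$. $\mathcal S^\star$ is the class of all existing pullbacks in $\mathcal C$ of conjugates $v^\star$ of $\mathcal S$-cospan morphisms $v$ with $v\in\mathcal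 S$. Quotients of $\mathsf{Span}(\mathcal C,\mathcal S)$ (all relations below are compatible equivalence relations): - $\mathsf{Retr}(\mathcal C,\mathcal S)$ is the quotient by $\sim_{\mathrm z}$, the least equivalence relation relating $(s,f)$ and $(\tilde s,\tilde f)$ whenever there is a morphism $x:(s,f)\to(\tilde s,\tilde f)$ with $x\in\mathcal S$. - $\mathsf{Par}(\mathcal C,\mathcal S)$ is the quotient by $\sim_{\mathrm z^\star}$, the least equivalence relation relating $(s,f)$ and $(\tilde s,\tilde f)$ whenever there is a morphism $x:(s,f)\to(\tilde s,\tilde f)$ with $x\in\mathcal S^\star$. - $\mathsf{Sect}(\mathcal C,\mathcal S)$ is the quotient by $\sim_{\mathrm a}$, the equivalence relation generated by $\approx_{\mathrm a}$, where $\approx_{\mathrm a}$ is the least compatible relation such that $\langle f,s\rangle\preceq\langle g,t\rangle$ implies $\mathrm{pb}\langle f,s\rangle\approx_{\mathrm a}\mathrm{pb}\langle g,t\rangle$. $\Phi_{\mathrm a}:\mathcal C\to\mathsf{Sect}(\mathcal C,\mathcal S)$ is the functor $f\mapsto[1,f]_{\mathrm a}$. *)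

theory Defs
  imports Main
begin

record ('o, 'a) cat =
  Obj :: "'o set"
  Arr :: "'a set"
  Dom :: "'a \<Rightarrow> 'o"
  Cod :: "'a \<Rightarrow> 'o"
  Ident :: "'o \<Rightarrow> 'a"
  Comp :: "'a \<Rightarrow> 'a \<Rightarrow> 'a"  (infixl "\<cdot>\<index>" 70)

text \<open>\<open>g \<cdot> f\<close> is ``\<open>g\<close> after \<open>f\<close>''; its value is irrelevant unless \<open>Cod f = Dom g\<close>.\<close>

locale category =
  fixes C :: "('o, 'a) cat" (structure)
  assumes Dom_Obj: "f \<in> Arr C \<Longrightarrow> Dom C f \<in> Obj C"
    and Cod_Obj: "f \<in> Arr C \<Longrightarrow> Cod C f \<in> Obj C"
    and Ident_Arr: "A \<in> Obj C \<Longrightarrow> Ident C A \<in> Arr C"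
    and Dom_Ident: "A \<in> Obj C \<Longrightarrow> Dom C (Ident C A) = A"
    and Cod_Ident: "A \<in> Obj C \<Longrightarrow> Cod C (Ident C A) = A"
    and Comp_Arr: "\<lbrakk>f \<in> Arr C; g \<in> Arr C; Cod C f = Dom C g\<rbrakk> \<Longrightarrow> g \<cdot> f \<in> Arr C"
    and Dom_Comp: "\<lbrakk>f \<in> Arr C; g \<in> Arr C; Cod C f = Dom C g\<rbrakk> \<Longrightarrow> Dom C (g \<cdot> f) = Dom C f"
    and Cod_Comp: "\<lbrakk>f \<in> Arr C; g \<in> Arr C; Cod C f = Dom C g\<rbrakk> \<Longrightarrow> Cod C (g \<cdot> f) = Cod C g"
    and Comp_Ident: "f \<in> Arr C \<Longrightarrow> f \<cdot> Ident C (Dom C f) = f"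
    and Ident_Comp: "f \<in> Arr C \<Longrightarrow> Ident C (Cod C f) \<cdot> f = f"
    and Comp_assoc: "\<lbrakk>f \<in> Arr C; g \<in> Arr C; h \<in> Arr C; Cod C f = Dom C g; Cod C g = Dom C h\<rbrakk>
      \<Longrightarrow> h \<cdot> (g \<cdot> f) = (h \<cdot> g) \<cdot> f"

definition is_iso :: "('o, 'a) cat \<Rightarrow> 'a \<Rightarrow> bool" where
  "is_iso C f \<longleftrightarrow> f \<in> Arr C \<and>
     (\<exists>g \<in> Arr C. Dom C g = Cod C f \<and> Cod C g = Dom C f \<and>
        g \<cdot>\<^bsub>C\<^esub> f = Ident C (Dom C f) \<and> f \<cdot>\<^bsub>C\<^esub> g = Ident C (Cod C f))"

definition is_pullback :: "('o, 'a) cat \<Rightarrow> 'a \<Rightarrow> 'a \<Rightarrow> 'a \<Rightarrow> 'a \<Rightarrow> bool" where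
  \<comment> \<open>\<open>f \<cdot> p = g \<cdot> q\<close> is a pullback square\<close>
  "is_pullback C f g p q \<longleftrightarrow>
     {f, g, p, q} \<subseteq> Arr C \<and> Cod C f = Cod C g \<and> Dom C p = Dom C q \<and>
     Cod C p = Dom C f \<and> Cod C q = Dom C g \<and> f \<cdot>\<^bsub>C\<^esub> p = g \<cdot>\<^bsub>C\<^esub> q \<and>
     (\<forall>h \<in> Arr C. \<forall>k \<in> Arr C.
        Dom C h = Dom C k \<and> Cod C h = Dom C f \<and> Cod C k = Dom C g \<and> f \<cdot>\<^bsub>C\<^esub> h = g \<cdot>\<^bsub>C\<^esub> k \<longrightarrow>
        (\<exists>!u. u \<in> Arr C \<and> Dom C u = Dom C h \<and> Cod C u = Dom C p \<and>
           p \<cdot>\<^bsub>C\<^esub> u = h \<and> q \<cdot>\<^bsub>C\<^esub> u = k))"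

locale is_functor = X: category X + Y: category Y
  for X :: "('o, 'a) cat" and Y :: "('p, 'b) cat" and Fo :: "'o \<Rightarrow> 'p" and Fa :: "'a \<Rightarrow> 'b" +
  assumes Fo_Obj: "A \<in> Obj X \<Longrightarrow> Fo A \<in> Obj Y"
    and Fa_Arr: "f \<in> Arr X \<Longrightarrow> Fa f \<in> Arr Y"
    and Fa_Dom: "f \<in> Arr X \<Longrightarrow> Dom Y (Fa f) = Fo (Dom X f)"
    and Fa_Cod: "f \<in> Arr X \<Longrightarrow> Cod Y (Fa f) = Fo (Cod X f)"
    and Fa_Ident: "A \<in> Obj X \<Longrightarrow> Fa (Ident X A) = Ident Y (Fo A)"
    and Fa_Comp: "\<lbrakk>f \<in> Arr X; g \<in> Arr X; Cod X f = Dom X g\<rbrakk>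
      \<Longrightarrow> Fa (g \<cdot>\<^bsub>X\<^esub> f) = Fa g \<cdot>\<^bsub>Y\<^esub> Fa f"

definition is_iso_functor ::
  "('o, 'a) cat \<Rightarrow> ('p, 'b) cat \<Rightarrow> ('o \<Rightarrow> 'p) \<Rightarrow> ('a \<Rightarrow> 'b) \<Rightarrow> bool" where
  "is_iso_functor X Y Fo Fa \<longleftrightarrow>
     is_functor X Y Fo Fa \<and> bij_betw Fo (Obj X) (Obj Y) \<and> bij_betw Fa (Arr X) (Arr Y)"

definition congruence :: "('o, 'a) cat \<Rightarrow> ('a \<times> 'a) set \<Rightarrow> bool" where
  "congruence X R \<longleftrightarrow> equiv (Arr X) R \<and>
     (\<forall>(f, f') \<in> R. Dom X f = Dom X f' \<and> Cod X f = Cod X f') \<and>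
     (\<forall>(f, f') \<in> R. \<forall>(g, g') \<in> R. Cod X f = Dom X g \<longrightarrow> (g \<cdot>\<^bsub>X\<^esub> f, g' \<cdot>\<^bsub>X\<^esub> f') \<in> R)"

definition quot_cat :: "('o, 'a) cat \<Rightarrow> ('a \<times> 'a) set \<Rightarrow> ('o, 'a set) cat" where
  "quot_cat X R = \<lparr> Obj = Obj X, Arr = Arr X // R,
     Dom = (\<lambda>K. the_elem (Dom X ` K)), Cod = (\<lambda>K. the_elem (Cod X ` K)),
     Ident = (\<lambda>A. R `` {Ident X A}),
     Comp = (\<lambda>L K. R `` {g \<cdot>\<^bsub>X\<^esub> f | f g. f \<in> K \<and> g \<in> L \<and> Cod X f = Dom X g}) \<rparr>"

text \<open>The functor \<open>Q\<close> exhibits \<open>Y\<close> as a quotient category of \<open>X\<close>: up to an isomorphism of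
  categories it is the canonical functor from \<open>X\<close> to its quotient by some congruence.\<close>

definition is_quotient_category ::
  "('o, 'a) cat \<Rightarrow> ('p, 'b) cat \<Rightarrow> ('o \<Rightarrow> 'p) \<Rightarrow> ('a \<Rightarrow> 'b) \<Rightarrow> bool" where
  "is_quotient_category X Y Qo Qa \<longleftrightarrow>
     (\<exists>R Go Ga. congruence X R \<and> is_iso_functor (quot_cat X R) Y Go Ga \<and>
        (\<forall>A \<in> Obj X. Go A = Qo A) \<and> (\<forall>f \<in> Arr X. Ga (R `` {f}) = Qa f))"

definition factors_through ::
  "('o, 'a) cat \<Rightarrow> ('r, 'c) cat \<Rightarrow> ('o \<Rightarrow> 'r) \<Rightarrow> ('a \<Rightarrow> 'c) \<Rightarrow>
   ('p, 'b) cat \<Rightarrow> ('o \<Rightarrow> 'p) \<Rightarrow> ('a \<Rightarrow> 'b) \<Rightarrow> ('r \<Rightarrow> 'p) \<Rightarrow> ('c \<Rightarrow> 'b) \<Rightarrow> bool" where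
  "factors_through X L Qo Qa D Fo Fa Go Ga \<longleftrightarrow>
     is_functor L D Go Ga \<and>
     (\<forall>A \<in> Obj X. Go (Qo A) = Fo A) \<and> (\<forall>f \<in> Arr X. Ga (Qa f) = Fa f)"

text \<open>\<open>L\<close> with \<open>Q : X \<rightarrow> L\<close> is the category of fractions of \<open>X\<close> at \<open>\<Sigma>\<close>.  HOL cannot quantify
  over types inside a formula, so the carrier types \<open>'p\<close>, \<open>'b\<close> of the test categories \<open>D\<close> are
  passed as tokens; the full universal property is the statement for free type variables
  \<open>'p\<close>, \<open>'b\<close>.  Functors are compared on the objects and arrows of their domain only.\<close>

definition is_category_of_fractions ::
  "'p itself \<Rightarrow> 'b itself \<Rightarrow> ('o, 'a) cat \<Rightarrow> 'a set \<Rightarrow>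
   ('r, 'c) cat \<Rightarrow> ('o \<Rightarrow> 'r) \<Rightarrow> ('a \<Rightarrow> 'c) \<Rightarrow> bool" where
  "is_category_of_fractions _ _ X \<Sigma> L Qo Qa \<longleftrightarrow>
     is_functor X L Qo Qa \<and> (\<forall>x \<in> \<Sigma>. is_iso L (Qa x)) \<and>
     (\<forall>(D :: ('p, 'b) cat) Fo Fa.
        is_functor X D Fo Fa \<and> (\<forall>x \<in> \<Sigma>. is_iso D (Fa x)) \<longrightarrow>
        (\<exists>Go Ga. factors_through X L Qo Qa D Fo Fa Go Ga \<and>
           (\<forall>Go' Ga'. factors_through X L Qo Qa D Fo Fa Go' Ga' \<longrightarrow>
              (\<forall>A \<in> Obj L. Go' A = Go A) \<and> (\<forall>f \<in> Arr L. Ga' f = Ga f))))"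

text \<open>The universal property determines the category up to isomorphism, so that
  ``\<open>L\<close> is isomorphic to the category of fractions'' and ``\<open>L\<close>, with a suitable functor, is a
  category of fractions'' are the same assertion.\<close>

lemma is_functor_comp:
  assumes "is_functor X Y Fo Fa" and "is_functor Y Z Go Ga"
  shows "is_functor X Z (Go \<circ> Fo) (Ga \<circ> Fa)"
proof -
  interpret F: is_functor X Y Fo Fa by fact
  interpret G: is_functor Y Z Go Ga by fact
  show ?thesis
    by unfold_locales
      (simp_all add: F.Fo_Obj F.Fa_Arr F.Fa_Dom F.Fa_Cod F.Fa_Ident F.Fa_Comp
        G.Fo_Obj G.Fa_Arr G.Fa_Dom G.Fa_Cod G.Fa_Ident G.Fa_Comp)
qed

lemma is_functor_id: "category X \<Longrightarrow> is_functor X X (\<lambda>A. A) (\<lambda>f. f)"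
  by (simp add: is_functor_def is_functor_axioms_def)

lemma is_category_of_fractions_unique:
  fixes X :: "('o, 'a) cat" and L :: "('r, 'c) cat" and L' :: "('s, 'd) cat"
  assumes "is_category_of_fractions TYPE('r) TYPE('c) X \<Sigma> L Qo Qa"
    and "is_category_of_fractions TYPE('s) TYPE('d) X \<Sigma> L Qo Qa"
    and "is_category_of_fractions TYPE('r) TYPE('c) X \<Sigma> L' Po Pa"
    and "is_category_of_fractions TYPE('s) TYPE('d) X \<Sigma> L' Po Pa"
  shows "\<exists>Go Ga. is_iso_functor L L' Go Ga \<and> factors_through X L Qo Qa L' Po Pa Go Ga"
proof -
  have Q: "is_functor X L Qo Qa" "\<forall>x \<in> \<Sigma>. is_iso L (Qa x)"
    and P: "is_functor X L' Po Pa" "\<forall>x \<in> \<Sigma>. is_iso L' (Pa x)"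
    using assms(1,3) by (simp_all add: is_category_of_fractions_def)
  obtain Go Ga where G: "factors_through X L Qo Qa L' Po Pa Go Ga"
    using assms(2) P unfolding is_category_of_fractions_def by blast
  obtain Ho Ha where H: "factors_through X L' Po Pa L Qo Qa Ho Ha"
    using assms(3) Q unfolding is_category_of_fractions_def by blast
  have L: "category L" and L': "category L'"
    using Q(1) P(1) by (simp_all add: is_functor_def)
  have "factors_through X L Qo Qa L Qo Qa (Ho \<circ> Go) (Ha \<circ> Ga)"
    using G H by (auto simp: factors_through_def intro: is_functor_comp)
  moreover have "factors_through X L Qo Qa L Qo Qa (\<lambda>A. A) (\<lambda>f. f)"
    using L by (simp add: factors_through_def is_functor_id)
  ultimately have HG: "\<And>A. A \<in> Obj L \<Longrightarrow> Ho (Go A) = A" "\<And>f. f \<in> Arr L \<Longrightarrow> Ha (Ga f) = f"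
    using assms(1) Q unfolding is_category_of_fractions_def by (metis comp_apply)+
  have "factors_through X L' Po Pa L' Po Pa (Go \<circ> Ho) (Ga \<circ> Ha)"
    using G H by (auto simp: factors_through_def intro: is_functor_comp)
  moreover have "factors_through X L' Po Pa L' Po Pa (\<lambda>A. A) (\<lambda>f. f)"
    using L' by (simp add: factors_through_def is_functor_id)
  ultimately have GH: "\<And>A. A \<in> Obj L' \<Longrightarrow> Go (Ho A) = A" "\<And>f. f \<in> Arr L' \<Longrightarrow> Ga (Ha f) = f"
    using assms(4) P unfolding is_category_of_fractions_def by (metis comp_apply)+
  have Gf: "is_functor L L' Go Ga" and Hf: "is_functor L' L Ho Ha"
    using G H by (simp_all add: factors_through_def)
  have "bij_betw Go (Obj L) (Obj L')"
    by (rule bij_betw_byWitness[where f' = Ho])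
      (auto simp: HG GH intro: is_functor.Fo_Obj[OF Gf] is_functor.Fo_Obj[OF Hf])
  moreover have "bij_betw Ga (Arr L) (Arr L')"
    by (rule bij_betw_byWitness[where f' = Ha])
      (auto simp: HG GH intro: is_functor.Fa_Arr[OF Gf] is_functor.Fa_Arr[OF Hf])
  ultimately show ?thesis
    using G Gf unfolding is_iso_functor_def by blast
qed

locale stable_class = category C
  for C :: "('o, 'a) cat" (structure) and S :: "'a set" +
  assumes S_Arr: "S \<subseteq> Arr C"
    and S_iso: "is_iso C f \<Longrightarrow> f \<in> S"
    and S_comp: "\<lbrakk>s \<in> S; t \<in> S; Cod C s = Dom C t\<rbrakk> \<Longrightarrow> t \<cdot> s \<in> S"
    and S_pullback_exists: "\<lbrakk>s \<in> S; f \<in> Arr C; Cod C f = Cod C s\<rbrakk>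
      \<Longrightarrow> \<exists>s' f'. is_pullback C f s s' f'"
    and S_pullback_closed: "\<lbrakk>s \<in> S; is_pullback C f s s' f'\<rbrakk> \<Longrightarrow> s' \<in> S"

definition weakly_left_cancellable :: "('o, 'a) cat \<Rightarrow> 'a set \<Rightarrow> bool" where
  "weakly_left_cancellable C S \<longleftrightarrow>
     (\<forall>s \<in> S. \<forall>t \<in> Arr C. Cod C t = Dom C s \<and> s \<cdot>\<^bsub>C\<^esub> t \<in> S \<longrightarrow> t \<in> S)"

type_synonym 'a span = "'a \<times> 'a"

definition spans :: "('o, 'a) cat \<Rightarrow> 'a set \<Rightarrow> 'a span set" where
  "spans C S = {(s, f). s \<in> S \<and> f \<in> Arr C \<and> Dom C s = Dom C f}"

definition src :: "('o, 'a) cat \<Rightarrow> 'a span \<Rightarrow> 'o" where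
  "src C p = Cod C (fst p)"

definition tgt :: "('o, 'a) cat \<Rightarrow> 'a span \<Rightarrow> 'o" where
  "tgt C p = Cod C (snd p)"

definition span_mor :: "('o, 'a) cat \<Rightarrow> 'a span \<Rightarrow> 'a span \<Rightarrow> 'a \<Rightarrow> bool" where
  "span_mor C p q x \<longleftrightarrow>
     x \<in> Arr C \<and> Dom C x = Dom C (fst p) \<and> Cod C x = Dom C (fst q) \<and>
     fst q \<cdot>\<^bsub>C\<^esub> x = fst p \<and> snd q \<cdot>\<^bsub>C\<^esub> x = snd p"

definition span_rel :: "('o, 'a) cat \<Rightarrow> 'a set \<Rightarrow> ('a \<Rightarrow> bool) \<Rightarrow> 'a span rel" where
  "span_rel C S P = {(p, q). p \<in> spans C S \<and> q \<in> spans C S \<and> (\<exists>x. span_mor C p q x \<and> P x)}"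

definition span_iso :: "('o, 'a) cat \<Rightarrow> 'a set \<Rightarrow> 'a span rel" where
  "span_iso C S = span_rel C S (is_iso C)"

text \<open>All horizontal composites \<open>q \<cdot> p\<close>, for all choices of the pullback; they form one
  isomorphism class of spans.\<close>

fun hcomp :: "('o, 'a) cat \<Rightarrow> 'a span \<Rightarrow> 'a span \<Rightarrow> 'a span set" where
  "hcomp C (t, g) (s, f) =
     {(s \<cdot>\<^bsub>C\<^esub> t', g \<cdot>\<^bsub>C\<^esub> f') | t' f'. is_pullback C f t t' f'}"

definition Span :: "('o, 'a) cat \<Rightarrow> 'a set \<Rightarrow> ('o, 'a span set) cat" where
  "Span C S = \<lparr> Obj = Obj C, Arr = spans C S // span_iso C S,
     Dom = (\<lambda>K. the_elem (src C ` K)), Cod = (\<lambda>K. the_elem (tgt C ` K)),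
     Ident = (\<lambda>A. span_iso C S `` {(Ident C A, Ident C A)}),
     Comp = (\<lambda>L K. \<Union>p \<in> K. \<Union>q \<in> L. hcomp C q p) \<rparr>"

definition compatible :: "('o, 'a) cat \<Rightarrow> 'a set \<Rightarrow> 'a span rel \<Rightarrow> bool" where
  "compatible C S R \<longleftrightarrow>
     R \<subseteq> spans C S \<times> spans C S \<and>
     (\<forall>(p, q) \<in> R. src C p = src C q \<and> tgt C p = tgt C q) \<and>
     span_iso C S \<subseteq> R \<and>
     (\<forall>(p, q) \<in> R. \<forall>r \<in> spans C S.
        hcomp C r p \<times> hcomp C r q \<subseteq> R \<and> hcomp C p r \<times> hcomp C q r \<subseteq> R)"

definition equiv_closure :: "'b set \<Rightarrow> 'b rel \<Rightarrow> 'b rel" where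
  "equiv_closure A R = \<Inter>{E. equiv A E \<and> R \<subseteq> E}"

text \<open>The relation on arrows of \<open>Span C S\<close> (isomorphism classes) induced by a relation for
  spans, and the quotient of \<open>Span C S\<close> by it.\<close>

definition class_rel :: "('o, 'a) cat \<Rightarrow> 'a set \<Rightarrow> 'a span rel \<Rightarrow> 'a span set rel" where
  "class_rel C S R =
     {(K, L). K \<in> Arr (Span C S) \<and> L \<in> Arr (Span C S) \<and> (\<exists>p \<in> K. \<exists>q \<in> L. (p, q) \<in> R)}"

definition span_quot ::
  "('o, 'a) cat \<Rightarrow> 'a set \<Rightarrow> 'a span rel \<Rightarrow> ('o, 'a span set set) cat" where
  "span_quot C S R = quot_cat (Span C S) (class_rel C S R)"

text \<open>The arrow \<open>[s, f]\<close> of the quotient of \<open>Span C S\<close> by \<open>R\<close>.\<close>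

definition span_class ::
  "('o, 'a) cat \<Rightarrow> 'a set \<Rightarrow> 'a span rel \<Rightarrow> 'a span \<Rightarrow> 'a span set set" where
  "span_class C S R p = class_rel C S R `` {span_iso C S `` {p}}"

definition cospans :: "('o, 'a) cat \<Rightarrow> 'a set \<Rightarrow> ('a \<times> 'a) set" where
  "cospans C S = {(f, s). f \<in> Arr C \<and> s \<in> S \<and> Cod C f = Cod C s}"

definition cospan_mor :: "('o, 'a) cat \<Rightarrow> 'a \<times> 'a \<Rightarrow> 'a \<times> 'a \<Rightarrow> 'a \<Rightarrow> bool" where
  "cospan_mor C c d v \<longleftrightarrow>
     v \<in> Arr C \<and> Dom C v = Cod C (fst c) \<and> Cod C v = Cod C (fst d) \<and>
     v \<cdot>\<^bsub>C\<^esub> fst c = fst d \<and> v \<cdot>\<^bsub>C\<^esub> snd c = snd d"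

text \<open>All representatives of the span obtained from a cospan by pullback.\<close>

fun pb :: "('o, 'a) cat \<Rightarrow> 'a \<times> 'a \<Rightarrow> 'a span set" where
  "pb C (f, s) = {(s', f'). is_pullback C f s s' f'}"

text \<open>\<open>w\<close> is a conjugate of some cospan morphism in \<open>S\<close>, for some choice of the pullbacks.\<close>

definition is_conjugate :: "('o, 'a) cat \<Rightarrow> 'a set \<Rightarrow> 'a \<Rightarrow> bool" where
  "is_conjugate C S w \<longleftrightarrow>
     (\<exists>c \<in> cospans C S. \<exists>d \<in> cospans C S. \<exists>v \<in> S. cospan_mor C c d v \<and>
        (\<exists>p \<in> pb C c. \<exists>q \<in> pb C d. span_mor C p q w))"

definition S_star :: "('o, 'a) cat \<Rightarrow> 'a set \<Rightarrow> 'a set" where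
  "S_star C S = {x. \<exists>w h h'. is_conjugate C S w \<and> is_pullback C h w x h'}"

definition sim_z :: "('o, 'a) cat \<Rightarrow> 'a set \<Rightarrow> 'a span rel" where
  "sim_z C S = equiv_closure (spans C S) (span_rel C S (\<lambda>x. x \<in> S))"

definition sim_zstar :: "('o, 'a) cat \<Rightarrow> 'a set \<Rightarrow> 'a span rel" where
  "sim_zstar C S = equiv_closure (spans C S) (span_rel C S (\<lambda>x. x \<in> S_star C S))"

definition approx_a :: "('o, 'a) cat \<Rightarrow> 'a set \<Rightarrow> 'a span rel" where
  "approx_a C S = \<Inter>{R. compatible C S R \<and>
     (\<forall>c \<in> cospans C S. \<forall>d \<in> cospans C S. (\<exists>v \<in> S. cospan_mor C c d v) \<longrightarrow>
        pb C c \<times> pb C d \<subseteq> R)}"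

definition sim_a :: "('o, 'a) cat \<Rightarrow> 'a set \<Rightarrow> 'a span rel" where
  "sim_a C S = equiv_closure (spans C S) (approx_a C S)"

definition Retr :: "('o, 'a) cat \<Rightarrow> 'a set \<Rightarrow> ('o, 'a span set set) cat" where
  "Retr C S = span_quot C S (sim_z C S)"

definition Par :: "('o, 'a) cat \<Rightarrow> 'a set \<Rightarrow> ('o, 'a span set set) cat" where
  "Par C S = span_quot C S (sim_zstar C S)"

definition Sect :: "('o, 'a) cat \<Rightarrow> 'a set \<Rightarrow> ('o, 'a span set set) cat" where
  "Sect C S = span_quot C S (sim_a C S)"

definition Phi_a :: "('o, 'a) cat \<Rightarrow> 'a set \<Rightarrow> 'a \<Rightarrow> 'a span set set" where
  "Phi_a C S f = span_class C S (sim_a C S) (Ident C (Dom C f), f)"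

definition Phi_z :: "('o, 'a) cat \<Rightarrow> 'a set \<Rightarrow> 'a \<Rightarrow> 'a span set set" where
  "Phi_z C S f = span_class C S (sim_z C S) (Ident C (Dom C f), f)"

text \<open>The functors \<open>Sect \<rightarrow> Par\<close> and \<open>Sect \<rightarrow> Retr\<close> that are identical on objects and send the
  \<open>sim_a\<close>-class of a span to its \<open>sim_zstar\<close>- and \<open>sim_z\<close>-class, respectively.\<close>

definition Sect_to_Par :: "('o, 'a) cat \<Rightarrow> 'a set \<Rightarrow> 'a span set set \<Rightarrow> 'a span set set" where
  "Sect_to_Par C S K = class_rel C S (sim_zstar C S) `` K"

definition Sect_to_Retr :: "('o, 'a) cat \<Rightarrow> 'a set \<Rightarrow> 'a span set set \<Rightarrow> 'a span set set" where
  "Sect_to_Retr C S K = class_rel C S (sim_z C S) `` K"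

end

theory Submission
  imports Defs
begin

text \<open>Classes of morphisms that contain the isomorphisms and are stable under pullback give
  compatible relations for spans; this applies to \<open>S\<close> and, because pullback squares paste, to
  \<open>S_star\<close>.  A conjugate of a cospan morphism lies in \<open>S_star\<close>, so \<open>sim_a\<close> is contained in
  \<open>sim_zstar\<close>, which is contained in \<open>sim_z\<close> when \<open>S_star \<subseteq> S\<close>.

  For \<open>s \<in> S\<close> the cospan morphism \<open>s\<close> from \<open>(1, 1)\<close> to \<open>(s, s)\<close> shows \<open>[s, 1] \<cdot> [1, s] = 1\<close> already in
  \<open>Sect\<close>, while \<open>[1, s] \<cdot> [s, 1] = [s, s]\<close> is the identity as soon as \<open>s\<close> itself is among the
  generators of the relation.  Hence \<open>S\<close> becomes invertible in \<open>Retr\<close>, and a functor \<open>F\<close> inverting \<open>S\<close>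
  extends to \<open>[s, f]\<close> as the unique \<open>y\<close> with \<open>y \<cdot> F s = F f\<close>.  Likewise a functor \<open>F\<close> on \<open>Sect\<close> that inverts
  \<open>[1, x]\<close> for \<open>x \<in> S_star\<close> must send \<open>[x, x]\<close> to an identity, and
  \<open>[s \<cdot> x, f \<cdot> x] = [1, f] \<cdot> [x, x] \<cdot> [s, 1]\<close> shows that \<open>F\<close> is constant on \<open>sim_zstar\<close>-classes.\<close>

section \<open>Pullbacks\<close>

context category
begin

lemmas cat_simps = Dom_Obj Cod_Obj Ident_Arr Dom_Ident Cod_Ident Comp_Arr Dom_Comp Cod_Comp

section \<open>Identities and isomorphisms\<close>

lemma Comp_Ident': "\<lbrakk>f \<in> Arr C; Dom C f = A\<rbrakk> \<Longrightarrow> f \<cdot> Ident C A = f"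
  using Comp_Ident by blast

lemma Ident_Comp': "\<lbrakk>f \<in> Arr C; Cod C f = A\<rbrakk> \<Longrightarrow> Ident C A \<cdot> f = f"
  using Ident_Comp by blast

lemma is_isoE:
  assumes "is_iso C f"
  obtains g where "f \<in> Arr C" "g \<in> Arr C" "Dom C g = Cod C f" "Cod C g = Dom C f"
    "g \<cdot> f = Ident C (Dom C f)" "f \<cdot> g = Ident C (Cod C f)"
  using assms unfolding is_iso_def by blast

lemma iso_cancel_left:
  assumes "is_iso C p" "u \<in> Arr C" "v \<in> Arr C" "Cod C u = Dom C p" "Cod C v = Dom C p"
    "p \<cdot> u = p \<cdot> v"
  shows "u = v"
proof -
  obtain i where i: "p \<in> Arr C" "i \<in> Arr C" "Dom C i = Cod C p" "Cod C i = Dom C p"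
    "i \<cdot> p = Ident C (Dom C p)"
    using assms(1) by (rule is_isoE)
  have "i \<cdot> (p \<cdot> u) = i \<cdot> (p \<cdot> v)"
    using assms by simp
  then have "(i \<cdot> p) \<cdot> u = (i \<cdot> p) \<cdot> v"
    using assms(2-5) i(1-4) by (simp add: Comp_assoc)
  then show ?thesis
    using assms i by (simp add: Ident_Comp')
qed

lemma iso_cancel_right:
  assumes "is_iso C p" "u \<in> Arr C" "v \<in> Arr C" "Dom C u = Cod C p" "Dom C v = Cod C p"
    "u \<cdot> p = v \<cdot> p"
  shows "u = v"
proof -
  obtain i where i: "p \<in> Arr C" "i \<in> Arr C" "Dom C i = Cod C p" "Cod C i = Dom C p"
    "p \<cdot> i = Ident C (Cod C p)"
    using assms(1) by (rule is_isoE)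
  have "(u \<cdot> p) \<cdot> i = (v \<cdot> p) \<cdot> i"
    using assms by simp
  then have "u \<cdot> (p \<cdot> i) = v \<cdot> (p \<cdot> i)"
    using assms(2-5) i(1-4) by (simp add: Comp_assoc)
  then show ?thesis
    using assms i by (simp add: Comp_Ident')
qed

lemma iso_Ident: "A \<in> Obj C \<Longrightarrow> is_iso C (Ident C A)"
  unfolding is_iso_def by (auto simp: cat_simps Comp_Ident' intro!: bexI[of _ "Ident C A"])

lemma iso_comp:
  assumes "is_iso C f" "is_iso C g" "Cod C f = Dom C g"
  shows "is_iso C (g \<cdot> f)"
proof -
  obtain i where i: "f \<in> Arr C" "i \<in> Arr C" "Dom C i = Cod C f" "Cod C i = Dom C f"
    "i \<cdot> f = Ident C (Dom C f)" "f \<cdot> i = Ident C (Cod C f)"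
    using assms(1) by (rule is_isoE)
  obtain j where j: "g \<in> Arr C" "j \<in> Arr C" "Dom C j = Cod C g" "Cod C j = Dom C g"
    "j \<cdot> g = Ident C (Dom C g)" "g \<cdot> j = Ident C (Cod C g)"
    using assms(2) by (rule is_isoE)
  have "(i \<cdot> j) \<cdot> (g \<cdot> f) = i \<cdot> ((j \<cdot> g) \<cdot> f)"
    using i(1-4) j(1-4) assms(3) by (simp add: cat_simps Comp_assoc)
  moreover have "(g \<cdot> f) \<cdot> (i \<cdot> j) = g \<cdot> ((f \<cdot> i) \<cdot> j)"
    using i(1-4) j(1-4) assms(3) by (simp add: cat_simps Comp_assoc)
  ultimately show ?thesis
    unfolding is_iso_def using i j assms(3)
    by (auto simp: cat_simps Comp_Ident' Ident_Comp' intro!: bexI[of _ "i \<cdot> j"])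
qed

section \<open>The universal property of pullbacks\<close>

lemma pullbackD:
  assumes "is_pullback C f g p q"
  shows "f \<in> Arr C" "g \<in> Arr C" "p \<in> Arr C" "q \<in> Arr C" "Cod C f = Cod C g"
    "Dom C p = Dom C q" "Cod C p = Dom C f" "Cod C q = Dom C g" "f \<cdot> p = g \<cdot> q"
  using assms unfolding is_pullback_def by auto

lemma pullback_lift:
  assumes "is_pullback C f g p q" "h \<in> Arr C" "k \<in> Arr C" "Dom C h = Dom C k"
    "Cod C h = Dom C f" "Cod C k = Dom C g" "f \<cdot> h = g \<cdot> k"
  obtains u where "u \<in> Arr C" "Dom C u = Dom C h" "Cod C u = Dom C p" "p \<cdot> u = h" "q \<cdot> u = k"
  using assms unfolding is_pullback_def by blast

lemma pullback_unique:
  assumes P: "is_pullback C f g p q" and u: "u \<in> Arr C" "Cod C u = Dom C p"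
    and v: "v \<in> Arr C" "Cod C v = Dom C p" "Dom C u = Dom C v"
    and e: "p \<cdot> u = p \<cdot> v" "q \<cdot> u = q \<cdot> v"
  shows "u = v"
proof -
  note d = pullbackD[OF P]
  have ex: "\<forall>h \<in> Arr C. \<forall>k \<in> Arr C.
      Dom C h = Dom C k \<and> Cod C h = Dom C f \<and> Cod C k = Dom C g \<and> f \<cdot> h = g \<cdot> k \<longrightarrow>
      (\<exists>!u. u \<in> Arr C \<and> Dom C u = Dom C h \<and> Cod C u = Dom C p \<and> p \<cdot> u = h \<and> q \<cdot> u = k)"
    using P unfolding is_pullback_def by (elim conjE)
  have "f \<cdot> (p \<cdot> u) = g \<cdot> (q \<cdot> u)"
    using d u by (simp add: Comp_assoc)
  moreover have "p \<cdot> u \<in> Arr C" "q \<cdot> u \<in> Arr C" "Dom C (p \<cdot> u) = Dom C u" "Dom C (q \<cdot> u) = Dom C u"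
    "Cod C (p \<cdot> u) = Dom C f" "Cod C (q \<cdot> u) = Dom C g"
    using d u by (simp_all add: cat_simps)
  ultimately have "\<exists>!w. w \<in> Arr C \<and> Dom C w = Dom C (p \<cdot> u) \<and> Cod C w = Dom C p \<and>
      p \<cdot> w = p \<cdot> u \<and> q \<cdot> w = q \<cdot> u"
    by (intro ex[rule_format]) simp_all
  then obtain w where w: "\<And>y. y \<in> Arr C \<and> Dom C y = Dom C (p \<cdot> u) \<and> Cod C y = Dom C p \<and>
      p \<cdot> y = p \<cdot> u \<and> q \<cdot> y = q \<cdot> u \<Longrightarrow> y = w"
    by (elim ex1E) blast
  have "Dom C (p \<cdot> u) = Dom C u"
    using d(3) u by (simp add: cat_simps)
  then have "u = w" "v = w"
    using u v e by (auto intro!: w)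
  then show ?thesis
    by simp
qed

text \<open>Splitting the unique existence of the definition into existence of a lift and joint
  cancellability of \<open>p\<close> and \<open>q\<close> lets pasting arguments treat the two
  halves separately.\<close>

lemma pullbackI:
  assumes "f \<in> Arr C" "g \<in> Arr C" "p \<in> Arr C" "q \<in> Arr C" "Cod C f = Cod C g"
    "Dom C p = Dom C q" "Cod C p = Dom C f" "Cod C q = Dom C g" "f \<cdot> p = g \<cdot> q"
    and "\<And>h k. \<lbrakk>h \<in> Arr C; k \<in> Arr C; Dom C h = Dom C k; Cod C h = Dom C f; Cod C k = Dom C g;
       f \<cdot> h = g \<cdot> k\<rbrakk>
      \<Longrightarrow> \<exists>u. u \<in> Arr C \<and> Dom C u = Dom C h \<and> Cod C u = Dom C p \<and> p \<cdot> u = h \<and> q \<cdot> u = k"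
    and "\<And>u v. \<lbrakk>u \<in> Arr C; v \<in> Arr C; Dom C u = Dom C v; Cod C u = Dom C p; Cod C v = Dom C p;
       p \<cdot> u = p \<cdot> v; q \<cdot> u = q \<cdot> v\<rbrakk> \<Longrightarrow> u = v"
  shows "is_pullback C f g p q"
  unfolding is_pullback_def
proof (intro conjI ballI impI)
  fix h k
  assume hk: "h \<in> Arr C" "k \<in> Arr C"
    "Dom C h = Dom C k \<and> Cod C h = Dom C f \<and> Cod C k = Dom C g \<and> f \<cdot> h = g \<cdot> k"
  then obtain u where "u \<in> Arr C" "Dom C u = Dom C h" "Cod C u = Dom C p" "p \<cdot> u = h" "q \<cdot> u = k"
    using assms(10)[of h k] by blast
  then show "\<exists>!u. u \<in> Arr C \<and> Dom C u = Dom C h \<and> Cod C u = Dom C p \<and> p \<cdot> u = h \<and> q \<cdot> u = k"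
    using assms(11) by (intro ex1I[of _ u]) auto
qed (use assms in auto)

lemma pullback_flip:
  assumes P: "is_pullback C f g p q"
  shows "is_pullback C g f q p"
proof (rule pullbackI)
  fix h k
  assume hk: "h \<in> Arr C" "k \<in> Arr C" "Dom C h = Dom C k" "Cod C h = Dom C g" "Cod C k = Dom C f"
    "g \<cdot> h = f \<cdot> k"
  then obtain u where "u \<in> Arr C" "Dom C u = Dom C k" "Cod C u = Dom C p" "p \<cdot> u = k" "q \<cdot> u = h"
    using pullback_lift[OF P, of k h] by metis
  then show "\<exists>u. u \<in> Arr C \<and> Dom C u = Dom C h \<and> Cod C u = Dom C q \<and> q \<cdot> u = h \<and> p \<cdot> u = k"
    using hk pullbackD[OF P] by auto
qed (use pullbackD[OF P] pullback_unique[OF P] in auto)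

section \<open>Isomorphisms and pullback squares\<close>

lemma pullback_of_isos:
  assumes "is_iso C g" "is_iso C p" "f \<in> Arr C" "q \<in> Arr C" "Cod C f = Cod C g"
    "Dom C p = Dom C q" "Cod C p = Dom C f" "Cod C q = Dom C g" "f \<cdot> p = g \<cdot> q"
  shows "is_pullback C f g p q"
proof -
  obtain i where i: "p \<in> Arr C" "i \<in> Arr C" "Dom C i = Cod C p" "Cod C i = Dom C p"
    "i \<cdot> p = Ident C (Dom C p)" "p \<cdot> i = Ident C (Cod C p)"
    using assms(2) by (rule is_isoE)
  have g: "g \<in> Arr C"
    using assms(1) by (simp add: is_iso_def)
  show ?thesis
  proof (rule pullbackI)
    fix h k
    assume hk: "h \<in> Arr C" "k \<in> Arr C" "Dom C h = Dom C k" "Cod C h = Dom C f" "Cod C k = Dom C g"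
      "f \<cdot> h = g \<cdot> k"
    \<comment> \<open>The first leg forces the lift of \<open>(h, k)\<close> to be
      \<open>i \<cdot> h\<close>; that its second leg is \<open>k\<close> becomes visible after
      composing with the isomorphism \<open>g\<close>, which is then cancelled.\<close>
    have ph: "p \<cdot> (i \<cdot> h) = h"
      using assms hk i by (simp add: Comp_assoc Ident_Comp')
    have "g \<cdot> (q \<cdot> (i \<cdot> h)) = (g \<cdot> q) \<cdot> (i \<cdot> h)"
      using assms hk i g by (simp add: cat_simps Comp_assoc)
    also have "\<dots> = f \<cdot> (p \<cdot> (i \<cdot> h))"
      using assms(3-8) hk(1-5) i(1-4) by (simp add: cat_simps Comp_assoc flip: assms(9))
    finally have "g \<cdot> (q \<cdot> (i \<cdot> h)) = g \<cdot> k"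
      using ph hk by simp
    then have "q \<cdot> (i \<cdot> h) = k"
      using assms(3-8) hk(1-5) i(1-4) g by - (rule iso_cancel_left[OF assms(1)], simp_all add: cat_simps)
    with ph show "\<exists>u. u \<in> Arr C \<and> Dom C u = Dom C h \<and> Cod C u = Dom C p \<and> p \<cdot> u = h \<and> q \<cdot> u = k"
      using assms(3-8) hk(1-5) i(1-4) by (intro exI[of _ "i \<cdot> h"]) (simp add: cat_simps)
  qed (use assms(3-9) g i(1) iso_cancel_left[OF assms(2)] in auto)
qed

lemma pullback_Ident:
  "f \<in> Arr C \<Longrightarrow> is_pullback C f (Ident C (Cod C f)) (Ident C (Dom C f)) f"
  by (rule pullback_of_isos) (simp_all add: iso_Ident cat_simps Comp_Ident Ident_Comp)

text \<open>With \<open>j\<close> inverse to \<open>g\<close>, the pair of an identity and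
  \<open>j \<cdot> f\<close> lifts to a section \<open>v\<close> of \<open>p\<close>; joint
  cancellability of the projections makes \<open>v \<cdot> p\<close> an identity as well.\<close>

lemma pullback_iso:
  assumes P: "is_pullback C f g p q" and i: "is_iso C g"
  shows "is_iso C p"
proof -
  note d = pullbackD[OF P]
  obtain j where j: "j \<in> Arr C" "Dom C j = Cod C g" "Cod C j = Dom C g"
    "j \<cdot> g = Ident C (Dom C g)" "g \<cdot> j = Ident C (Cod C g)"
    using i by (rule is_isoE)
  have "f \<cdot> Ident C (Dom C f) = g \<cdot> (j \<cdot> f)"
    using d j by (simp add: cat_simps Comp_assoc Comp_Ident Ident_Comp')
  then obtain v where v: "v \<in> Arr C" "Dom C v = Dom C f" "Cod C v = Dom C p"
    "p \<cdot> v = Ident C (Dom C f)" "q \<cdot> v = j \<cdot> f"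
    using pullback_lift[OF P, of "Ident C (Dom C f)" "j \<cdot> f"] d j by (auto simp: cat_simps)
  have "q \<cdot> (v \<cdot> p) = j \<cdot> (f \<cdot> p)"
    using d(1-8) j v by (simp add: cat_simps Comp_assoc)
  also have "\<dots> = q"
    using d j by (simp add: cat_simps Comp_assoc Ident_Comp')
  finally have "q \<cdot> (v \<cdot> p) = q" .
  moreover have "p \<cdot> (v \<cdot> p) = p"
    using d v by (simp add: cat_simps Comp_assoc Ident_Comp')
  ultimately have "v \<cdot> p = Ident C (Dom C p)"
    using d(1-8) v(1-3) by - (rule pullback_unique[OF P], simp_all add: cat_simps Comp_Ident')
  then show ?thesis
    unfolding is_iso_def using d v by (auto intro!: bexI[of _ v])
qed

section \<open>Pasting and cancellation of pullback squares\<close>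

lemma pullback_cancel:
  assumes P: "is_pullback C f g p q" and O: "is_pullback C (f \<cdot> a) g p' q'"
    and a: "a \<in> Arr C" "Cod C a = Dom C f"
    and u: "u \<in> Arr C" "Dom C u = Dom C p'" "Cod C u = Dom C p" "p \<cdot> u = a \<cdot> p'" "q \<cdot> u = q'"
  shows "is_pullback C a p p' u"
proof -
  note d = pullbackD[OF P] and e = pullbackD[OF O]
  show ?thesis
  proof (rule pullbackI)
    fix h k
    assume hk: "h \<in> Arr C" "k \<in> Arr C" "Dom C h = Dom C k" "Cod C h = Dom C a" "Cod C k = Dom C p"
      "a \<cdot> h = p \<cdot> k"
    have "(f \<cdot> a) \<cdot> h = f \<cdot> (p \<cdot> k)"
      using hk a d by (simp flip: Comp_assoc)
    also have "\<dots> = g \<cdot> (q \<cdot> k)"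
      using hk d by (simp add: Comp_assoc)
    finally obtain w where w: "w \<in> Arr C" "Dom C w = Dom C h" "Cod C w = Dom C p'"
      "p' \<cdot> w = h" "q' \<cdot> w = q \<cdot> k"
      using pullback_lift[OF O, of h "q \<cdot> k"] hk a d e by (auto simp: cat_simps)
    \<comment> \<open>The lift through the outer rectangle is only known to satisfy
      \<open>p' \<cdot> w = h\<close> and \<open>q' \<cdot> w = q \<cdot> k\<close>;
      \<open>u \<cdot> w = k\<close> follows because both sides agree after \<open>p\<close> and
      after \<open>q\<close>.\<close>
    have "p \<cdot> (u \<cdot> w) = p \<cdot> k"
      using w u(1-3) a d e(1-8) hk(6) by (simp add: Comp_assoc u(4)) (simp add: cat_simps flip: Comp_assoc)
    moreover have "q \<cdot> (u \<cdot> w) = q \<cdot> k"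
      using w u(1-3) d(1-8) by (simp add: Comp_assoc u(5))
    ultimately have "u \<cdot> w = k"
      using w(1-3) u(1-3) hk(1-5) d(1-8) by - (rule pullback_unique[OF P], simp_all add: cat_simps)
    with w show "\<exists>u'. u' \<in> Arr C \<and> Dom C u' = Dom C h \<and> Cod C u' = Dom C p' \<and> p' \<cdot> u' = h \<and> u \<cdot> u' = k"
      by auto
  next
    fix v w
    assume vw: "v \<in> Arr C" "w \<in> Arr C" "Dom C v = Dom C w" "Cod C v = Dom C p'" "Cod C w = Dom C p'"
      "p' \<cdot> v = p' \<cdot> w" "u \<cdot> v = u \<cdot> w"
    have "q \<cdot> (u \<cdot> v) = q \<cdot> (u \<cdot> w)"
      using vw by simp
    then have "q' \<cdot> v = q' \<cdot> w"
      using vw(1-5) u(1-3) d(1-8) by (simp add: Comp_assoc u(5))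
    then show "v = w"
      using vw by - (rule pullback_unique[OF O], auto)
  qed (use a u(1-3) u(4)[symmetric] d(1-8) e(1-8) in \<open>auto simp: cat_simps\<close>)
qed

text \<open>A cone over the outer cospan is lifted in two stages: through the square on
  \<open>f\<close>, giving \<open>m\<close>, and then through the one on \<open>a\<close>. Iterated
  pullbacks in composites of spans and in \<open>S_star\<close> are reduced to single ones in this
  way.\<close>

lemma pullback_paste:
  assumes P: "is_pullback C f g p q" and R: "is_pullback C a p p' u"
  shows "is_pullback C (f \<cdot> a) g p' (q \<cdot> u)"
proof -
  note d = pullbackD[OF P] and e = pullbackD[OF R]
  show ?thesis
  proof (rule pullbackI)
    have "(f \<cdot> a) \<cdot> p' = f \<cdot> (p \<cdot> u)"
      using d e by (simp flip: Comp_assoc)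
    also have "\<dots> = g \<cdot> (q \<cdot> u)"
      using d e(1-8) by (simp add: Comp_assoc)
    finally show "(f \<cdot> a) \<cdot> p' = g \<cdot> (q \<cdot> u)" .
  next
    fix h k
    assume hk: "h \<in> Arr C" "k \<in> Arr C" "Dom C h = Dom C k" "Cod C h = Dom C (f \<cdot> a)"
      "Cod C k = Dom C g" "(f \<cdot> a) \<cdot> h = g \<cdot> k"
    have ha: "Cod C h = Dom C a"
      using hk d e by (simp add: cat_simps)
    have "f \<cdot> (a \<cdot> h) = g \<cdot> k"
      using hk d e ha by (simp add: Comp_assoc)
    then obtain m where m: "m \<in> Arr C" "Dom C m = Dom C h" "Cod C m = Dom C p"
      "p \<cdot> m = a \<cdot> h" "q \<cdot> m = k"
      using pullback_lift[OF P, of "a \<cdot> h" k] hk ha d e by (auto simp: cat_simps)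
    obtain w where w: "w \<in> Arr C" "Dom C w = Dom C h" "Cod C w = Dom C p'" "p' \<cdot> w = h" "u \<cdot> w = m"
      using pullback_lift[OF R, of h m] hk ha m by (auto simp: cat_simps)
    have "(q \<cdot> u) \<cdot> w = k"
      using w m d e(1-8) by (simp flip: Comp_assoc)
    with w show "\<exists>w. w \<in> Arr C \<and> Dom C w = Dom C h \<and> Cod C w = Dom C p' \<and> p' \<cdot> w = h \<and> (q \<cdot> u) \<cdot> w = k"
      by auto
  next
    fix v w
    assume vw: "v \<in> Arr C" "w \<in> Arr C" "Dom C v = Dom C w" "Cod C v = Dom C p'" "Cod C w = Dom C p'"
      "p' \<cdot> v = p' \<cdot> w" "(q \<cdot> u) \<cdot> v = (q \<cdot> u) \<cdot> w"
    have "a \<cdot> (p' \<cdot> v) = a \<cdot> (p' \<cdot> w)"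
      using vw by simp
    then have "p \<cdot> (u \<cdot> v) = p \<cdot> (u \<cdot> w)"
      using vw(1-5) d e by (simp add: Comp_assoc)
    moreover have "q \<cdot> (u \<cdot> v) = q \<cdot> (u \<cdot> w)"
      using vw d e by (simp add: Comp_assoc)
    ultimately have "u \<cdot> v = u \<cdot> w"
      using vw(1-5) d(1-8) e(1-8) by - (rule pullback_unique[OF P], simp_all add: cat_simps)
    then show "v = w"
      using vw by - (rule pullback_unique[OF R], auto)
  qed (use d e in \<open>simp_all add: cat_simps\<close>)
qed

text \<open>A pullback is determined only up to an isomorphism of its vertex; the change of vertex
  is pasted on as a square with an identity and \<open>x\<close> as opposite sides.\<close>

lemma pullback_comp_iso:
  assumes P: "is_pullback C f g p q" and x: "is_iso C x" "Cod C x = Dom C p"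
  shows "is_pullback C f g (p \<cdot> x) (q \<cdot> x)"
proof -
  note d = pullbackD[OF P]
  have xa: "x \<in> Arr C"
    using x by (simp add: is_iso_def)
  have "is_pullback C p (Ident C (Dom C f)) x (p \<cdot> x)"
    using d x xa by (intro pullback_of_isos) (simp_all add: iso_Ident cat_simps Ident_Comp')
  then have "is_pullback C (Ident C (Dom C f)) p (p \<cdot> x) x"
    by (rule pullback_flip)
  from pullback_paste[OF P this] show ?thesis
    using d by (simp add: Comp_Ident)
qed

end

section \<open>Relations for spans\<close>

lemma equiv_closure_equiv:
  assumes "R \<subseteq> A \<times> A"
  shows "equiv A (equiv_closure A R)"
proof -
  \<comment> \<open>The full relation on \<open>A\<close> belongs to the intersected family because
    it contains \<open>R\<close>; this bounds the intersection by
    \<open>A \<times> A\<close>.\<close>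
  have "equiv A (A \<times> A)"
    by (auto simp: equiv_def refl_on_def sym_def trans_def)
  then have "equiv_closure A R \<subseteq> A \<times> A"
    using assms unfolding equiv_closure_def by blast
  moreover have "refl_on A (equiv_closure A R)"
    unfolding equiv_closure_def equiv_def refl_on_def by blast
  moreover have "sym (equiv_closure A R)"
    unfolding equiv_closure_def equiv_def by (intro symI InterI) (blast dest: symD)
  moreover have "trans (equiv_closure A R)"
    unfolding equiv_closure_def equiv_def by (intro transI InterI) (blast dest: transD)
  ultimately show ?thesis
    by (rule equivI)
qed

lemma equiv_closure_incl: "R \<subseteq> equiv_closure A R"
  unfolding equiv_closure_def by blast

lemma equiv_closure_least: "\<lbrakk>equiv A E; R \<subseteq> E\<rbrakk> \<Longrightarrow> equiv_closure A R \<subseteq> E"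
  unfolding equiv_closure_def by blast

section \<open>Compatible relations and horizontal composites\<close>

lemma compatibleD:
  assumes "compatible C S R"
  shows "(p, q) \<in> R \<Longrightarrow> p \<in> spans C S" "(p, q) \<in> R \<Longrightarrow> q \<in> spans C S"
    "(p, q) \<in> R \<Longrightarrow> src C p = src C q" "(p, q) \<in> R \<Longrightarrow> tgt C p = tgt C q"
    "span_iso C S \<subseteq> R"
    "\<lbrakk>(p, q) \<in> R; r \<in> spans C S; a \<in> hcomp C r p; b \<in> hcomp C r q\<rbrakk> \<Longrightarrow> (a, b) \<in> R"
    "\<lbrakk>(p, q) \<in> R; r \<in> spans C S; a \<in> hcomp C p r; b \<in> hcomp C q r\<rbrakk> \<Longrightarrow> (a, b) \<in> R"
  using assms unfolding compatible_def by blast+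

lemma compatibleI:
  assumes "\<And>p q. (p, q) \<in> R \<Longrightarrow> p \<in> spans C S \<and> q \<in> spans C S \<and> src C p = src C q \<and> tgt C p = tgt C q"
    and "span_iso C S \<subseteq> R"
    and "\<And>p q r a b. \<lbrakk>(p, q) \<in> R; r \<in> spans C S; a \<in> hcomp C r p; b \<in> hcomp C r q\<rbrakk> \<Longrightarrow> (a, b) \<in> R"
    and "\<And>p q r a b. \<lbrakk>(p, q) \<in> R; r \<in> spans C S; a \<in> hcomp C p r; b \<in> hcomp C q r\<rbrakk> \<Longrightarrow> (a, b) \<in> R"
  shows "compatible C S R"
proof -
  have "R \<subseteq> spans C S \<times> spans C S" "\<forall>(p, q) \<in> R. src C p = src C q \<and> tgt C p = tgt C q"
    using assms(1) by auto
  moreover have "\<forall>(p, q) \<in> R. \<forall>r \<in> spans C S.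
      hcomp C r p \<times> hcomp C r q \<subseteq> R \<and> hcomp C p r \<times> hcomp C q r \<subseteq> R"
    using assms(3,4) by blast
  ultimately show ?thesis
    unfolding compatible_def using assms(2) by blast
qed

lemma hcompI: "is_pullback C f t t' f' \<Longrightarrow> (Comp C s t', Comp C g f') \<in> hcomp C (t, g) (s, f)"
  by auto

context stable_class
begin

lemma S_ArrD: "s \<in> S \<Longrightarrow> s \<in> Arr C"
  using S_Arr by blast

lemma Ident_S: "A \<in> Obj C \<Longrightarrow> Ident C A \<in> S"
  by (simp add: S_iso iso_Ident)

lemma spans_iff: "(s, f) \<in> spans C S \<longleftrightarrow> s \<in> S \<and> f \<in> Arr C \<and> Dom C s = Dom C f"
  by (simp add: spans_def)

lemma src_tgt: "src C (s, f) = Cod C s" "tgt C (s, f) = Cod C f"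
  by (simp_all add: src_def tgt_def)

lemma src_tgt_Obj: "p \<in> spans C S \<Longrightarrow> src C p \<in> Obj C \<and> tgt C p \<in> Obj C"
  by (cases p) (simp add: spans_iff src_tgt S_ArrD cat_simps)

text \<open>Besides the type of a composite, composability itself is recovered from membership in
  \<open>hcomp\<close>: a pullback square of \<open>f\<close> and \<open>t\<close> presupposes a
  common codomain.\<close>

lemma hcomp_spans:
  assumes "p \<in> spans C S" "q \<in> spans C S" "r \<in> hcomp C q p"
  shows "r \<in> spans C S" "src C r = src C p" "tgt C r = tgt C q" "tgt C p = src C q"
proof -
  obtain s f t g where pq: "p = (s, f)" "q = (t, g)"
    by (cases p, cases q) blast
  then obtain t' f' where r: "r = (s \<cdot> t', g \<cdot> f')" and P: "is_pullback C f t t' f'"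
    using assms(3) by auto
  note d = pullbackD[OF P]
  have s: "s \<in> S" "t \<in> S" "s \<in> Arr C" "g \<in> Arr C" "Dom C s = Dom C f" "Dom C t = Dom C g"
    using assms(1,2) pq by (auto simp: spans_iff S_ArrD)
  have t': "t' \<in> S"
    using s(2) P by (rule S_pullback_closed)
  have "s \<cdot> t' \<in> S"
    using t' s d(1-8) by (simp add: S_comp)
  then show "r \<in> spans C S" "src C r = src C p" "tgt C r = tgt C q" "tgt C p = src C q"
    unfolding pq r using t' s d(1-8) by (simp_all add: spans_iff src_tgt cat_simps)
qed

lemma hcomp_exists:
  assumes "p \<in> spans C S" "q \<in> spans C S" "tgt C p = src C q"
  obtains r where "r \<in> hcomp C q p"
proof -
  obtain s f t g where pq: "p = (s, f)" "q = (t, g)"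
    by (cases p, cases q) blast
  obtain t' f' where "is_pullback C f t t' f'"
    using assms pq S_pullback_exists[of t f] by (auto simp: spans_iff src_tgt)
  then show ?thesis
    using that pq by auto
qed

section \<open>Relations given by vertical morphisms\<close>

lemma span_rel_src_tgt:
  assumes "(p, q) \<in> span_rel C S P"
  shows "p \<in> spans C S" "q \<in> spans C S" "src C p = src C q" "tgt C p = tgt C q"
proof -
  obtain s f t g where pq: "p = (s, f)" "q = (t, g)"
    by (cases p, cases q) blast
  show "p \<in> spans C S" "q \<in> spans C S"
    using assms by (auto simp: span_rel_def)
  then show "src C p = src C q" "tgt C p = tgt C q"
    using assms pq Cod_Comp[of _ t] Cod_Comp[of _ g]
    by (auto simp: span_rel_def span_mor_def spans_iff src_tgt S_ArrD)
qed

text \<open>The pullbacks forming the two composites are linked by an induced morphism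
  \<open>u\<close> over \<open>x\<close>. Cancelling the square of \<open>b\<close> from that of
  \<open>a\<close> exhibits \<open>u\<close> as a pullback of \<open>x\<close>, so a pullback-stable
  \<open>P\<close> passes from \<open>x\<close> to \<open>u\<close>.\<close>

lemma span_rel_hcomp_left:
  assumes stable: "\<And>h w x h'. \<lbrakk>P w; is_pullback C h w x h'\<rbrakk> \<Longrightarrow> P x"
    and "(p, q) \<in> span_rel C S P" "r \<in> spans C S" "a \<in> hcomp C r p" "b \<in> hcomp C r q"
  shows "(a, b) \<in> span_rel C S P"
proof -
  obtain s f s2 f2 t g where pqr: "p = (s, f)" "q = (s2, f2)" "r = (t, g)"
    by (cases p, cases q, cases r) blast
  obtain x where "span_mor C p q x" "P x" and sp: "p \<in> spans C S" "q \<in> spans C S"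
    using assms(2) by (auto simp: span_rel_def)
  then have x: "x \<in> Arr C" "Dom C x = Dom C s" "Cod C x = Dom C s2" "s2 \<cdot> x = s" "f2 \<cdot> x = f"
    by (auto simp: span_mor_def pqr)
  have s: "s2 \<in> Arr C" "f2 \<in> Arr C" "Dom C s2 = Dom C f2" "g \<in> Arr C" "Dom C t = Dom C g"
    "Dom C s = Dom C f"
    using sp assms(3) by (auto simp: pqr spans_iff S_ArrD)
  obtain t' f' where a: "a = (s \<cdot> t', g \<cdot> f')" and P1: "is_pullback C f t t' f'"
    using assms(4) by (auto simp: pqr)
  obtain t2 f2' where b: "b = (s2 \<cdot> t2, g \<cdot> f2')" and P2: "is_pullback C f2 t t2 f2'"
    using assms(5) by (auto simp: pqr)
  note d1 = pullbackD[OF P1] and d2 = pullbackD[OF P2]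
  have "f2 \<cdot> (x \<cdot> t') = f \<cdot> t'"
    using x(1-3) s d1(1-8) by (simp add: Comp_assoc x(5))
  then have "f2 \<cdot> (x \<cdot> t') = t \<cdot> f'"
    using d1(9) by simp
  then obtain u where u: "u \<in> Arr C" "Dom C u = Dom C t'" "Cod C u = Dom C t2"
      "t2 \<cdot> u = x \<cdot> t'" "f2' \<cdot> u = f'"
    using x(1-3) s d1(1-8) d2(1-8) by - (rule pullback_lift[OF P2, of "x \<cdot> t'" f'], auto simp: cat_simps)
  have "is_pullback C x t2 t' u"
    using P2 P1 x(1) u x(3) s(3) unfolding x(5)[symmetric] by (intro pullback_cancel[OF P2]) simp_all
  then have "P u"
    using \<open>P x\<close> stable pullback_flip by blast
  have "(s2 \<cdot> t2) \<cdot> u = s \<cdot> t'"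
  proof -
    have "(s2 \<cdot> t2) \<cdot> u = s2 \<cdot> (t2 \<cdot> u)"
      using s d2(1-8) u(1-3) by (simp add: Comp_assoc)
    also have "\<dots> = (s2 \<cdot> x) \<cdot> t'"
      using s d1(1-8) x(1-3) by (simp add: Comp_assoc u(4))
    finally show ?thesis
      by (simp add: x(4))
  qed
  moreover have "(g \<cdot> f2') \<cdot> u = g \<cdot> f'"
  proof -
    have "(g \<cdot> f2') \<cdot> u = g \<cdot> (f2' \<cdot> u)"
      using s assms(3) d2(1-8) u(1-3) by (simp add: Comp_assoc pqr spans_iff)
    then show ?thesis
      by (simp add: u(5))
  qed
  moreover have "Dom C u = Dom C (s \<cdot> t')" "Cod C u = Dom C (s2 \<cdot> t2)"
    using u(1-3) s d1(1-8) d2(1-8) sp by (simp_all add: cat_simps pqr spans_iff S_ArrD)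
  ultimately have "span_mor C a b u"
    by (simp add: span_mor_def a b u(1))
  with \<open>P u\<close> show ?thesis
    using hcomp_spans(1)[OF sp(1) assms(3,4)] hcomp_spans(1)[OF sp(2) assms(3,5)]
    by (auto simp: span_rel_def)
qed

text \<open>The mirror case: the legs \<open>s\<close> and \<open>s2\<close> are now pulled back
  along \<open>g\<close>, and the squares are flipped before cancellation, since here the relevant
  factorization is \<open>s2 \<cdot> x = s\<close>.\<close>

lemma span_rel_hcomp_right:
  assumes stable: "\<And>h w x h'. \<lbrakk>P w; is_pullback C h w x h'\<rbrakk> \<Longrightarrow> P x"
    and "(p, q) \<in> span_rel C S P" "r \<in> spans C S" "a \<in> hcomp C p r" "b \<in> hcomp C q r"
  shows "(a, b) \<in> span_rel C S P"
proof -
  obtain s f s2 f2 t g where pqr: "p = (s, f)" "q = (s2, f2)" "r = (t, g)"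
    by (cases p, cases q, cases r) blast
  obtain x where "span_mor C p q x" "P x" and sp: "p \<in> spans C S" "q \<in> spans C S"
    using assms(2) by (auto simp: span_rel_def)
  then have x: "x \<in> Arr C" "Dom C x = Dom C s" "Cod C x = Dom C s2" "s2 \<cdot> x = s" "f2 \<cdot> x = f"
    by (auto simp: span_mor_def pqr)
  have s: "s2 \<in> Arr C" "f2 \<in> Arr C" "Dom C s2 = Dom C f2" "g \<in> Arr C" "Dom C t = Dom C g"
    "Dom C s = Dom C f" "t \<in> Arr C" "f \<in> Arr C"
    using sp assms(3) by (auto simp: pqr spans_iff S_ArrD)
  obtain s' g' where a: "a = (t \<cdot> s', f \<cdot> g')" and P1: "is_pullback C g s s' g'"
    using assms(4) by (auto simp: pqr)
  obtain s2' g2' where b: "b = (t \<cdot> s2', f2 \<cdot> g2')" and P2: "is_pullback C g s2 s2' g2'"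
    using assms(5) by (auto simp: pqr)
  note d1 = pullbackD[OF P1] and d2 = pullbackD[OF P2]
  have "g \<cdot> s' = s2 \<cdot> (x \<cdot> g')"
    using x(1-3) s d1(1-8) d1(9) by (simp add: Comp_assoc x(4))
  then obtain u where u: "u \<in> Arr C" "Dom C u = Dom C s'" "Cod C u = Dom C s2'"
      "s2' \<cdot> u = s'" "g2' \<cdot> u = x \<cdot> g'"
    using x(1-3) s d1(1-8) d2(1-8) by - (rule pullback_lift[OF P2, of s' "x \<cdot> g'"], auto simp: cat_simps)
  have "is_pullback C x g2' g' u"
    using pullback_flip[OF P1] x(1) u x(3) d1(6) d2(6) unfolding x(4)[symmetric]
    by (intro pullback_cancel[OF pullback_flip[OF P2]]) simp_all
  then have "P u"
    using \<open>P x\<close> stable pullback_flip by blast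
  have "(f2 \<cdot> g2') \<cdot> u = f \<cdot> g'"
  proof -
    have "(f2 \<cdot> g2') \<cdot> u = f2 \<cdot> (g2' \<cdot> u)"
      using s d2(1-8) u(1-3) by (simp add: Comp_assoc)
    also have "\<dots> = (f2 \<cdot> x) \<cdot> g'"
      using s d1(1-8) x(1-3) by (simp add: Comp_assoc u(5))
    finally show ?thesis
      by (simp add: x(5))
  qed
  moreover have "(t \<cdot> s2') \<cdot> u = t \<cdot> s'"
  proof -
    have "(t \<cdot> s2') \<cdot> u = t \<cdot> (s2' \<cdot> u)"
      using s d2(1-8) u(1-3) by (simp add: Comp_assoc)
    then show ?thesis
      by (simp add: u(4))
  qed
  moreover have "Dom C u = Dom C (t \<cdot> s')" "Cod C u = Dom C (t \<cdot> s2')"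
    using u(1-3) s d1(1-8) d2(1-8) by (simp_all add: cat_simps)
  ultimately have "span_mor C a b u"
    by (simp add: span_mor_def a b u(1))
  with \<open>P u\<close> show ?thesis
    using hcomp_spans(1)[OF assms(3) sp(1) assms(4)] hcomp_spans(1)[OF assms(3) sp(2) assms(5)]
    by (auto simp: span_rel_def)
qed

text \<open>One argument serves the isomorphisms, \<open>S\<close> and \<open>S_star C S\<close>:
  each of these classes contains the isomorphisms and is stable under pullback.\<close>

lemma compatible_span_rel:
  assumes "\<And>h w x h'. \<lbrakk>P w; is_pullback C h w x h'\<rbrakk> \<Longrightarrow> P x"
    and "\<And>x. is_iso C x \<Longrightarrow> P x"
  shows "compatible C S (span_rel C S P)"
proof (rule compatibleI)
  show "span_iso C S \<subseteq> span_rel C S P"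
    using assms(2) by (auto simp: span_iso_def span_rel_def)
next
  fix p q
  assume "(p, q) \<in> span_rel C S P"
  then show "p \<in> spans C S \<and> q \<in> spans C S \<and> src C p = src C q \<and> tgt C p = tgt C q"
    using span_rel_src_tgt by simp
next
  fix p q r a b
  assume *: "(p, q) \<in> span_rel C S P" "r \<in> spans C S"
  show "(a, b) \<in> span_rel C S P" if "a \<in> hcomp C r p" "b \<in> hcomp C r q"
    by (rule span_rel_hcomp_left[OF _ * that]) (rule assms(1))
  show "(a, b) \<in> span_rel C S P" if "a \<in> hcomp C p r" "b \<in> hcomp C q r"
    by (rule span_rel_hcomp_right[OF _ * that]) (rule assms(1))
qed

lemma compatible_span_iso: "compatible C S (span_iso C S)"
  unfolding span_iso_def by (rule compatible_span_rel) (rule pullback_iso)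

lemma equiv_span_iso: "equiv (spans C S) (span_iso C S)"
proof (rule equivI)
  show "span_iso C S \<subseteq> spans C S \<times> spans C S"
    by (auto simp: span_iso_def span_rel_def)
  show "refl_on (spans C S) (span_iso C S)"
  proof (rule refl_onI)
    fix p
    assume p: "p \<in> spans C S"
    then have "span_mor C p p (Ident C (Dom C (fst p)))"
      by (cases p) (simp add: span_mor_def spans_iff S_ArrD cat_simps Comp_Ident')
    then show "(p, p) \<in> span_iso C S"
      using p by (cases p) (auto simp: span_iso_def span_rel_def spans_iff S_ArrD cat_simps intro!: iso_Ident)
  qed
  show "sym (span_iso C S)"
  proof (rule symI)
    fix p q
    assume pq: "(p, q) \<in> span_iso C S"
    then obtain x where x: "span_mor C p q x" "is_iso C x" and sp: "p \<in> spans C S" "q \<in> spans C S"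
      by (auto simp: span_iso_def span_rel_def)
    obtain i where i: "x \<in> Arr C" "i \<in> Arr C" "Dom C i = Cod C x" "Cod C i = Dom C x"
      "i \<cdot> x = Ident C (Dom C x)" "x \<cdot> i = Ident C (Cod C x)"
      using x(2) by (rule is_isoE)
    have "is_iso C i"
      using i unfolding is_iso_def by auto
    obtain s f t g where e: "p = (s, f)" "q = (t, g)"
      by (cases p, cases q) blast
    have "t \<in> Arr C" "g \<in> Arr C" "Dom C t = Dom C g" "Cod C x = Dom C t" "Dom C x = Dom C s"
      "t \<cdot> x = s" "g \<cdot> x = f"
      using x(1) sp by (auto simp: e span_mor_def spans_iff S_ArrD)
    moreover from this(1-5) have "t \<cdot> (x \<cdot> i) = (t \<cdot> x) \<cdot> i" "g \<cdot> (x \<cdot> i) = (g \<cdot> x) \<cdot> i"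
      using i(1-4) by (simp_all add: Comp_assoc)
    ultimately have "span_mor C q p i"
      using i by (simp add: e span_mor_def Comp_Ident')
    then show "(q, p) \<in> span_iso C S"
      using \<open>is_iso C i\<close> sp by (auto simp: span_iso_def span_rel_def)
  qed
  show "trans (span_iso C S)"
  proof (rule transI)
    fix p q r
    assume "(p, q) \<in> span_iso C S" "(q, r) \<in> span_iso C S"
    then obtain x y where xy: "span_mor C p q x" "is_iso C x" "span_mor C q r y" "is_iso C y"
      and sp: "p \<in> spans C S" "q \<in> spans C S" "r \<in> spans C S"
      by (auto simp: span_iso_def span_rel_def)
    have "is_iso C (y \<cdot> x)"
      using xy by - (rule iso_comp, simp_all add: span_mor_def)
    moreover have "span_mor C p r (y \<cdot> x)"
      using xy sp by (cases p, cases q, cases r)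
        (simp add: span_mor_def spans_iff S_ArrD cat_simps Comp_assoc)
    ultimately show "(p, r) \<in> span_iso C S"
      using sp by (auto simp: span_iso_def span_rel_def)
  qed
qed

section \<open>Compatible equivalence relations\<close>

lemma compatible_refl:
  assumes "compatible C S R" "p \<in> spans C S"
  shows "(p, p) \<in> R"
proof -
  have "(p, p) \<in> span_iso C S"
    using equiv_span_iso assms(2) by (auto simp: equiv_def dest: refl_onD)
  then show ?thesis
    using compatibleD(5)[OF assms(1)] by blast
qed

text \<open>Compatibility changes one factor at a time, so the two composites are compared through a
  composite \<open>c\<close> of the mixed pair, which exists because related spans have equal
  targets.\<close>

lemma compatible_hcomp:
  assumes R: "compatible C S R" "trans R" and "(p, p') \<in> R" "(q, q') \<in> R"
    and "a \<in> hcomp C q p" "b \<in> hcomp C q' p'"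
  shows "(a, b) \<in> R"
proof -
  note D = compatibleD[OF R(1)]
  have sp: "p \<in> spans C S" "p' \<in> spans C S" "q \<in> spans C S" "q' \<in> spans C S"
    using assms(3,4) D(1,2) by blast+
  have "tgt C p' = src C q"
    using hcomp_spans(4)[OF sp(1,3) assms(5)] D(4)[OF assms(3)] by simp
  then obtain c where c: "c \<in> hcomp C q p'"
    using hcomp_exists sp by blast
  have "(a, c) \<in> R"
    by (rule D(6)[OF assms(3) sp(3) assms(5) c])
  moreover have "(c, b) \<in> R"
    by (rule D(7)[OF assms(4) sp(2) c assms(6)])
  ultimately show ?thesis
    using R(2) by (blast dest: transD)
qed

text \<open>Preservation by composition cannot be read off from the intersection defining the
  closure. Instead, the pairs of \<open>E\<close> whose composites with every \<open>r\<close> stay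
  in \<open>E\<close> form an equivalence relation \<open>?H\<close> containing \<open>R\<close>,
  and minimality yields \<open>E \<subseteq> ?H\<close>.\<close>

lemma compatible_equiv_closure:
  assumes R: "compatible C S R"
  shows "compatible C S (equiv_closure (spans C S) R)"
proof -
  define E where "E = equiv_closure (spans C S) R"
  note D = compatibleD[OF R]
  have RE: "R \<subseteq> E"
    unfolding E_def by (rule equiv_closure_incl)
  have E: "equiv (spans C S) E"
    unfolding E_def by (rule equiv_closure_equiv) (use D(1,2) in auto)
  \<comment> \<open>Sources and targets are propagated to the closure first: transitivity of
    \<open>?H\<close> needs a composite through the middle span, hence equal endpoints.\<close>
  let ?T = "{(p, q). p \<in> spans C S \<and> q \<in> spans C S \<and> src C p = src C q \<and> tgt C p = tgt C q}"
  have "E \<subseteq> ?T"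
    unfolding E_def by (rule equiv_closure_least)
      (use D(1-4) in \<open>auto simp: equiv_def refl_on_def sym_def trans_def\<close>)
  then have T: "p \<in> spans C S \<and> q \<in> spans C S \<and> src C p = src C q \<and> tgt C p = tgt C q"
    if "(p, q) \<in> E" for p q
    using that by blast
  let ?H = "{(p, q). (p, q) \<in> E \<and> (\<forall>r \<in> spans C S.
    (\<forall>a \<in> hcomp C r p. \<forall>b \<in> hcomp C r q. (a, b) \<in> E) \<and>
    (\<forall>a \<in> hcomp C p r. \<forall>b \<in> hcomp C q r. (a, b) \<in> E))}"
  have "equiv (spans C S) ?H"
  proof (rule equivI)
    show "?H \<subseteq> spans C S \<times> spans C S"
      using T by blast
    show "refl_on (spans C S) ?H"
    proof (rule refl_onI)
      fix p
      assume "p \<in> spans C S"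
      \<comment> \<open>Reflexivity of \<open>?H\<close> has content: two composites of the same
        pair may use different pullbacks, and compatibility of \<open>R\<close> is what relates
        them.\<close>
      then have "(p, p) \<in> R"
        by (rule compatible_refl[OF R])
      then show "(p, p) \<in> ?H"
        using D(6,7) RE by blast
    qed
    show "sym ?H"
      using E unfolding equiv_def sym_def by blast
    have trE: "(a, c) \<in> E" if "(a, b) \<in> E" "(b, c) \<in> E" for a b c
      using E that unfolding equiv_def by (blast dest: transD)
    show "trans ?H"
    proof (rule transI)
      fix p q q'
      assume 1: "(p, q) \<in> ?H" and 2: "(q, q') \<in> ?H"
      have sp: "p \<in> spans C S" "q \<in> spans C S" "q' \<in> spans C S" "src C p = src C q" "tgt C p = tgt C q"
        using 1 2 T by blast+
      have "(a, b) \<in> E" if r: "r \<in> spans C S" and ab: "a \<in> hcomp C r p" "b \<in> hcomp C r q'" for r a b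
      proof -
        have "tgt C q = src C r"
          using hcomp_spans(4)[OF sp(1) r ab(1)] sp(5) by simp
        then obtain c where "c \<in> hcomp C r q"
          using hcomp_exists[OF sp(2) r] by blast
        then have "(a, c) \<in> E" "(c, b) \<in> E"
          using 1 2 r ab by blast+
        then show ?thesis
          by (rule trE)
      qed
      moreover have "(a, b) \<in> E" if r: "r \<in> spans C S" and ab: "a \<in> hcomp C p r" "b \<in> hcomp C q' r" for r a b
      proof -
        have "tgt C r = src C q"
          using hcomp_spans(4)[OF r sp(1) ab(1)] sp(4) by simp
        then obtain c where "c \<in> hcomp C q r"
          using hcomp_exists[OF r sp(2)] by blast
        then have "(a, c) \<in> E" "(c, b) \<in> E"
          using 1 2 r ab by blast+
        then show ?thesis
          by (rule trE)
      qed
      moreover have "(p, q') \<in> E"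
        using 1 2 trE by blast
      ultimately show "(p, q') \<in> ?H"
        by blast
    qed
  qed
  then have "E \<subseteq> ?H"
    unfolding E_def by (rule equiv_closure_least[folded E_def]) (use RE D(6,7) in \<open>unfold E_def, blast\<close>)
  then show ?thesis
    unfolding E_def[symmetric] using T RE D(5) by (intro compatibleI) blast+
qed

section \<open>Closure under isomorphism, associativity and units of horizontal composition\<close>

lemma hcomp_iso_closed:
  assumes sp: "p \<in> spans C S" "q \<in> spans C S" and "r \<in> hcomp C q p" "(r', r) \<in> span_iso C S"
  shows "r' \<in> hcomp C q p"
proof -
  obtain s f t g where pq: "p = (s, f)" "q = (t, g)"
    by (cases p, cases q) blast
  then obtain t' f' where r: "r = (s \<cdot> t', g \<cdot> f')" and P: "is_pullback C f t t' f'"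
    using assms(3) by auto
  note d = pullbackD[OF P]
  have a: "s \<in> Arr C" "g \<in> Arr C" "Dom C s = Dom C f" "Dom C t = Dom C g"
    using sp pq by (auto simp: spans_iff S_ArrD)
  obtain x where x: "is_iso C x" "span_mor C r' r x"
    using assms(4) by (auto simp: span_iso_def span_rel_def)
  have x': "x \<in> Arr C" "Cod C x = Dom C t'" "fst r' = (s \<cdot> t') \<cdot> x" "snd r' = (g \<cdot> f') \<cdot> x"
    using x(2) a d(1-8) by (auto simp: r span_mor_def cat_simps)
  \<comment> \<open>Since \<open>hcomp\<close> admits every choice of pullback, the isomorphism
    \<open>x\<close> is absorbed into the projections.\<close>
  have "is_pullback C f t (t' \<cdot> x) (f' \<cdot> x)"
    using P x(1) x'(2) by (rule pullback_comp_iso)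
  moreover have "r' = (s \<cdot> (t' \<cdot> x), g \<cdot> (f' \<cdot> x))"
    using x' a d(1-8) by (cases r') (simp add: Comp_assoc)
  ultimately show ?thesis
    by (auto simp: pq)
qed

text \<open>Both bracketings are built on the same third pullback, of \<open>f'\<close> and
  \<open>u'\<close>, pasted to one or the other of the first two squares. As \<open>hcomp\<close>
  admits every choice of pullback, a single span lies in both iterated composites, and equality
  replaces a comparison isomorphism.\<close>

lemma hcomp_assoc:
  assumes sp: "p \<in> spans C S" "q \<in> spans C S" "r \<in> spans C S"
    and tgt: "tgt C p = src C q" "tgt C q = src C r"
  obtains qp rq x where "qp \<in> hcomp C q p" "rq \<in> hcomp C r q" "x \<in> hcomp C r qp" "x \<in> hcomp C rq p"
proof -
  obtain s f t g u h where e: "p = (s, f)" "q = (t, g)" "r = (u, h)"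
    by (cases p, cases q, cases r) blast
  have m: "s \<in> Arr C" "t \<in> Arr C" "u \<in> Arr C" "s \<in> S" "t \<in> S" "u \<in> S" "f \<in> Arr C" "g \<in> Arr C" "h \<in> Arr C"
    "Dom C s = Dom C f" "Dom C t = Dom C g" "Dom C u = Dom C h" "Cod C f = Cod C t" "Cod C g = Cod C u"
    using sp tgt by (auto simp: e spans_iff src_tgt S_ArrD)
  obtain t' f' where P1: "is_pullback C f t t' f'"
    using S_pullback_exists m by blast
  obtain u' g' where P2: "is_pullback C g u u' g'"
    using S_pullback_exists m by blast
  note d1 = pullbackD[OF P1] and d2 = pullbackD[OF P2]
  have "u' \<in> S"
    using m(6) P2 by (rule S_pullback_closed)
  then obtain a b where P3: "is_pullback C f' u' a b"
    using S_pullback_exists[of u' f'] d1(1-8) d2(1-8) m by auto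
  note d3 = pullbackD[OF P3]
  have "is_pullback C (g \<cdot> f') u a (g' \<cdot> b)"
    using P2 P3 by (rule pullback_paste)
  then have "((s \<cdot> t') \<cdot> a, h \<cdot> (g' \<cdot> b)) \<in> hcomp C r (s \<cdot> t', g \<cdot> f')"
    by (auto simp: e)
  moreover have "is_pullback C (t \<cdot> u') f b (t' \<cdot> a)"
    using pullback_flip[OF P1] pullback_flip[OF P3] by (rule pullback_paste)
  then have "(s \<cdot> (t' \<cdot> a), (h \<cdot> g') \<cdot> b) \<in> hcomp C (t \<cdot> u', h \<cdot> g') p"
    by (auto simp: e intro: pullback_flip)
  moreover have "((s \<cdot> t') \<cdot> a, h \<cdot> (g' \<cdot> b)) = (s \<cdot> (t' \<cdot> a), (h \<cdot> g') \<cdot> b)"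
    using m d1(1-8) d2(1-8) d3(1-8) by (simp add: Comp_assoc)
  ultimately show ?thesis
    using P1 P2 by (intro that[of "(s \<cdot> t', g \<cdot> f')" "(t \<cdot> u', h \<cdot> g')"]) (auto simp: e)
qed

lemma hcomp_Ident_right:
  assumes "(s, f) \<in> spans C S"
  shows "(s, f) \<in> hcomp C (s, f) (Ident C (Cod C s), Ident C (Cod C s))"
proof -
  have "s \<in> Arr C" "f \<in> Arr C" "Dom C s = Dom C f"
    using assms by (simp_all add: spans_iff S_ArrD)
  from this(1,2) this(3)[symmetric] have e: "Ident C (Cod C s) \<cdot> s = s" "f \<cdot> Ident C (Dom C s) = f"
    and P: "is_pullback C s (Ident C (Cod C s)) (Ident C (Dom C s)) s"
    by (simp_all add: Ident_Comp Comp_Ident' pullback_Ident)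
  show ?thesis
    using hcompI[OF pullback_flip[OF P], of "Ident C (Cod C s)" f] by (simp only: e)
qed

lemma hcomp_Ident_left:
  assumes "(s, f) \<in> spans C S"
  shows "(s, f) \<in> hcomp C (Ident C (Cod C f), Ident C (Cod C f)) (s, f)"
proof -
  have "s \<in> Arr C" "f \<in> Arr C" "Dom C s = Dom C f"
    using assms by (simp_all add: spans_iff S_ArrD)
  then have e: "s \<cdot> Ident C (Dom C f) = s" "Ident C (Cod C f) \<cdot> f = f"
    and P: "is_pullback C f (Ident C (Cod C f)) (Ident C (Dom C f)) f"
    by (simp_all add: Ident_Comp Comp_Ident' pullback_Ident)
  show ?thesis
    using hcompI[OF P, of s "Ident C (Cod C f)"] by (simp only: e)
qed

end

section \<open>Quotients of the category of spans\<close>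

text \<open>\<open>Y\<close> is a category whose arrows are the classes \<open>cl p\<close> of spans modulo \<open>E\<close>; this covers
  \<open>Span\<close> itself and all its quotients.\<close>

locale span_category = stable_class C S for C :: "('o, 'a) cat" (structure) and S +
  fixes E :: "'a span rel" and Y :: "('o, 'c) cat" and cl :: "'a span \<Rightarrow> 'c"
  assumes Obj_Y: "Obj Y = Obj C"
    and Arr_Y: "Arr Y = cl ` spans C S"
    and Dom_Y: "p \<in> spans C S \<Longrightarrow> Dom Y (cl p) = src C p"
    and Cod_Y: "p \<in> spans C S \<Longrightarrow> Cod Y (cl p) = tgt C p"
    and Ident_Y: "A \<in> Obj C \<Longrightarrow> Ident Y A = cl (Ident C A, Ident C A)"
    and Comp_Y: "\<lbrakk>p \<in> spans C S; q \<in> spans C S; r \<in> hcomp C q p\<rbrakk> \<Longrightarrow> Comp Y (cl q) (cl p) = cl r"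
    and cl_eq: "\<lbrakk>p \<in> spans C S; q \<in> spans C S\<rbrakk> \<Longrightarrow> cl p = cl q \<longleftrightarrow> (p, q) \<in> E"
begin

lemma cl_Arr: "p \<in> spans C S \<Longrightarrow> cl p \<in> Arr Y"
  by (simp add: Arr_Y)

lemma Ident_spans: "A \<in> Obj C \<Longrightarrow> (Ident C A, Ident C A) \<in> spans C S"
  by (simp add: spans_iff Ident_S cat_simps)

lemma Comp_Y_spans:
  assumes "f \<in> Arr Y" "g \<in> Arr Y" "Cod Y f = Dom Y g"
  obtains p q r where "p \<in> spans C S" "q \<in> spans C S" "r \<in> spans C S" "r \<in> hcomp C q p"
    "f = cl p" "g = cl q" "Comp Y g f = cl r"
proof -
  obtain p q where pq: "p \<in> spans C S" "q \<in> spans C S" "f = cl p" "g = cl q"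
    using assms by (auto simp: Arr_Y)
  then obtain r where r: "r \<in> hcomp C q p"
    using assms(3) hcomp_exists[of p q] by (auto simp: Dom_Y Cod_Y)
  show ?thesis
    using that[OF pq(1,2) hcomp_spans(1)[OF pq(1,2) r] r pq(3,4)] Comp_Y[OF pq(1,2) r] pq(3,4) by simp
qed

lemma category_Y: "category Y"
proof
  fix f
  assume "f \<in> Arr Y"
  then obtain s u where p: "(s, u) \<in> spans C S" "f = cl (s, u)"
    by (auto simp: Arr_Y)
  then have su: "s \<in> Arr C" "u \<in> Arr C"
    by (auto simp: spans_iff S_ArrD)
  show "Dom Y f \<in> Obj Y" "Cod Y f \<in> Obj Y"
    using p src_tgt_Obj by (auto simp: Dom_Y Cod_Y Obj_Y)
  show "Comp Y f (Ident Y (Dom Y f)) = f"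
    using p(1) su Comp_Y[OF Ident_spans p(1) hcomp_Ident_right] by (simp add: p(2) Dom_Y src_tgt Ident_Y cat_simps)
  show "Comp Y (Ident Y (Cod Y f)) f = f"
    using p(1) su Comp_Y[OF p(1) Ident_spans hcomp_Ident_left] by (simp add: p(2) Cod_Y src_tgt Ident_Y cat_simps)
next
  fix A
  assume "A \<in> Obj Y"
  then have A: "A \<in> Obj C"
    by (simp add: Obj_Y)
  then show "Ident Y A \<in> Arr Y" "Dom Y (Ident Y A) = A" "Cod Y (Ident Y A) = A"
    using Ident_spans[OF A] by (simp_all add: Ident_Y cl_Arr Dom_Y Cod_Y src_tgt cat_simps)
next
  fix f g
  assume "f \<in> Arr Y" "g \<in> Arr Y" "Cod Y f = Dom Y g"
  then obtain p q r where *: "p \<in> spans C S" "q \<in> spans C S" "r \<in> spans C S" "r \<in> hcomp C q p"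
    "f = cl p" "g = cl q" "Comp Y g f = cl r"
    by (rule Comp_Y_spans)
  then show "Comp Y g f \<in> Arr Y" "Dom Y (Comp Y g f) = Dom Y f" "Cod Y (Comp Y g f) = Cod Y g"
    using hcomp_spans[OF *(1,2,4)] by (simp_all add: Dom_Y Cod_Y cl_Arr)
next
  fix f g h
  assume "f \<in> Arr Y" "g \<in> Arr Y" "h \<in> Arr Y" "Cod Y f = Dom Y g" "Cod Y g = Dom Y h"
  then obtain p q r where sp: "p \<in> spans C S" "q \<in> spans C S" "r \<in> spans C S"
    and e: "f = cl p" "g = cl q" "h = cl r" and "tgt C p = src C q" "tgt C q = src C r"
    by (auto simp: Arr_Y Dom_Y Cod_Y)
  then obtain qp rq x where x: "qp \<in> hcomp C q p" "rq \<in> hcomp C r q" "x \<in> hcomp C r qp" "x \<in> hcomp C rq p"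
    using hcomp_assoc[of p q r] by blast
  then have "qp \<in> spans C S" "rq \<in> spans C S"
    using hcomp_spans(1) sp by blast+
  then show "Comp Y h (Comp Y g f) = Comp Y (Comp Y h g) f"
    using sp x by (simp add: e Comp_Y)
qed

section \<open>Functors out of categories of spans\<close>

lemma is_functor_Y:
  assumes "category D" and "\<And>A. A \<in> Obj C \<Longrightarrow> Fo A \<in> Obj D"
    and "\<And>p. p \<in> spans C S \<Longrightarrow> Fa (cl p) \<in> Arr D \<and> Dom D (Fa (cl p)) = Fo (src C p) \<and> Cod D (Fa (cl p)) = Fo (tgt C p)"
    and "\<And>A. A \<in> Obj C \<Longrightarrow> Fa (cl (Ident C A, Ident C A)) = Ident D (Fo A)"
    and "\<And>p q r. \<lbrakk>p \<in> spans C S; q \<in> spans C S; r \<in> hcomp C q p\<rbrakk>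
      \<Longrightarrow> Fa (cl r) = Comp D (Fa (cl q)) (Fa (cl p))"
  shows "is_functor Y D Fo Fa"
proof (intro is_functor.intro is_functor_axioms.intro category_Y assms(1))
  fix f g
  assume "f \<in> Arr Y" "g \<in> Arr Y" "Cod Y f = Dom Y g"
  then show "Fa (Comp Y g f) = Comp D (Fa g) (Fa f)"
    by (rule Comp_Y_spans) (use assms(5) in simp)
qed (use assms(2-4) in \<open>auto simp: Obj_Y Arr_Y Dom_Y Cod_Y Ident_Y\<close>)

text \<open>Values are read off a representative chosen by \<open>inv_into\<close>, and
  \<open>F_eq\<close> makes them independent of the choice. Both universal properties obtain their
  factorizations from this.\<close>

lemma functor_from_spans:
  assumes D: "category D" and Fo: "\<And>A. A \<in> Obj C \<Longrightarrow> Fo A \<in> Obj D"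
    and F: "\<And>p. p \<in> spans C S \<Longrightarrow> F p \<in> Arr D \<and> Dom D (F p) = Fo (src C p) \<and> Cod D (F p) = Fo (tgt C p)"
    and F_Ident: "\<And>A. A \<in> Obj C \<Longrightarrow> F (Ident C A, Ident C A) = Ident D (Fo A)"
    and F_Comp: "\<And>p q r. \<lbrakk>p \<in> spans C S; q \<in> spans C S; r \<in> hcomp C q p\<rbrakk> \<Longrightarrow> F r = Comp D (F q) (F p)"
    and F_eq: "\<And>p q. (p, q) \<in> E \<Longrightarrow> F p = F q"
  obtains Fa where "is_functor Y D Fo Fa" "\<And>p. p \<in> spans C S \<Longrightarrow> Fa (cl p) = F p"
proof -
  define Fa where "Fa K = F (inv_into (spans C S) cl K)" for K
  have Fa: "Fa (cl p) = F p" if p: "p \<in> spans C S" for p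
  proof -
    have "inv_into (spans C S) cl (cl p) \<in> spans C S" "cl (inv_into (spans C S) cl (cl p)) = cl p"
      using p by (auto intro: inv_into_into f_inv_into_f)
    then show ?thesis
      unfolding Fa_def using F_eq cl_eq p by blast
  qed
  have "is_functor Y D Fo Fa"
  proof (rule is_functor_Y[OF D Fo])
    fix p q r
    assume *: "p \<in> spans C S" "q \<in> spans C S" "r \<in> hcomp C q p"
    then have "r \<in> spans C S"
      by (rule hcomp_spans(1))
    then show "Fa (cl r) = Comp D (Fa (cl q)) (Fa (cl p))"
      using * by (simp add: Fa F_Comp)
  qed (simp_all add: F F_Ident Fa Ident_spans)
  then show ?thesis
    using that Fa by blast
qed

section \<open>Factorizations of spans\<close>

lemma cl_Comp_left:
  assumes "(s, f) \<in> spans C S" "g \<in> Arr C" "Cod C f = Dom C g"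
  shows "cl (s, g \<cdot> f) = Comp Y (cl (Ident C (Dom C g), g)) (cl (s, f))"
proof -
  have m: "s \<in> Arr C" "f \<in> Arr C" "Dom C s = Dom C f"
    using assms(1) by (auto simp: spans_iff S_ArrD)
  have "(s \<cdot> Ident C (Dom C f), g \<cdot> f) \<in> hcomp C (Ident C (Dom C g), g) (s, f)"
    using pullback_Ident[OF m(2)] unfolding assms(3) by (rule hcompI)
  moreover have "s \<cdot> Ident C (Dom C f) = s"
    using m by (simp add: Comp_Ident')
  moreover have "(Ident C (Dom C g), g) \<in> spans C S"
    using assms(2) by (simp add: spans_iff Ident_S cat_simps)
  ultimately show ?thesis
    using Comp_Y[OF assms(1)] by metis
qed

text \<open>The counterpart of \<open>cl_Comp_left\<close> on the source side. Together they isolate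
  the factor \<open>(x, x)\<close> in a span \<open>(t \<cdot> x, g \<cdot> x)\<close>, which is how
  functors inverting the units on \<open>S_star C S\<close> are analysed.\<close>

lemma cl_Comp_right:
  assumes "(t, g) \<in> spans C S" "s \<in> S" "Cod C t = Dom C s"
  shows "cl (s \<cdot> t, g) = Comp Y (cl (t, g)) (cl (s, Ident C (Dom C s)))"
proof -
  have m: "t \<in> Arr C" "s \<in> Arr C" "g \<in> Arr C" "Dom C t = Dom C g"
    using assms(1,2) by (auto simp: spans_iff S_ArrD)
  have "(s \<cdot> t, g \<cdot> Ident C (Dom C t)) \<in> hcomp C (t, g) (s, Ident C (Dom C s))"
    using pullback_flip[OF pullback_Ident[OF m(1)]] unfolding assms(3) by (rule hcompI)
  moreover have "g \<cdot> Ident C (Dom C t) = g"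
    using m by (simp add: Comp_Ident')
  moreover have "(s, Ident C (Dom C s)) \<in> spans C S"
    using assms(2) m by (simp add: spans_iff cat_simps)
  ultimately show ?thesis
    using Comp_Y[OF _ assms(1)] by metis
qed

text \<open>Reduces arbitrary arrows to the two kinds \<open>[1, f]\<close> and
  \<open>[s, 1]\<close>; it is \<open>cl_Comp_left\<close> applied to the span of \<open>s\<close>
  and an identity.\<close>

lemma cl_factor:
  assumes "(s, f) \<in> spans C S"
  shows "cl (s, f) = Comp Y (cl (Ident C (Dom C f), f)) (cl (s, Ident C (Dom C s)))"
proof -
  have m: "s \<in> Arr C" "f \<in> Arr C" "Dom C s = Dom C f" "s \<in> S"
    using assms by (auto simp: spans_iff S_ArrD)
  then have "(s, Ident C (Dom C s)) \<in> spans C S"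
    by (simp add: spans_iff cat_simps)
  from cl_Comp_left[OF this m(2)] show ?thesis
    using m by (simp add: cat_simps Comp_Ident')
qed

lemma is_functor_unit: "is_functor C Y (\<lambda>A. A) (\<lambda>f. cl (Ident C (Dom C f), f))"
proof (intro is_functor.intro is_functor_axioms.intro category_Y category_axioms)
  have sp: "(Ident C (Dom C f), f) \<in> spans C S" if "f \<in> Arr C" for f
    using that by (simp add: spans_iff Ident_S cat_simps)
  fix f
  assume f: "f \<in> Arr C"
  show "cl (Ident C (Dom C f), f) \<in> Arr Y" "Dom Y (cl (Ident C (Dom C f), f)) = Dom C f"
    "Cod Y (cl (Ident C (Dom C f), f)) = Cod C f"
    using sp[OF f] f by (simp_all add: cl_Arr Dom_Y Cod_Y src_tgt cat_simps)
  fix g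
  assume g: "g \<in> Arr C" "Cod C f = Dom C g"
  show "cl (Ident C (Dom C (g \<cdot> f)), g \<cdot> f) =
      Comp Y (cl (Ident C (Dom C g), g)) (cl (Ident C (Dom C f), f))"
    using cl_Comp_left[OF sp[OF f] g] f g by (simp add: cat_simps)
qed (simp_all add: Obj_Y Ident_Y cat_simps)

end

subsection \<open>Quotient categories\<close>

lemma the_elem_image_const: "\<lbrakk>a \<in> K; \<And>x. x \<in> K \<Longrightarrow> F x = c\<rbrakk> \<Longrightarrow> the_elem (F ` K) = c"
proof -
  assume "a \<in> K" "\<And>x. x \<in> K \<Longrightarrow> F x = c"
  then have "F ` K = {c}"
    by force
  then show ?thesis
    by simp
qed

lemma congruenceD:
  assumes "congruence X R"
  shows "equiv (Arr X) R" "(f, f') \<in> R \<Longrightarrow> Dom X f = Dom X f'" "(f, f') \<in> R \<Longrightarrow> Cod X f = Cod X f'"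
    "\<lbrakk>(f, f') \<in> R; (g, g') \<in> R; Cod X f = Dom X g\<rbrakk> \<Longrightarrow> (g \<cdot>\<^bsub>X\<^esub> f, g' \<cdot>\<^bsub>X\<^esub> f') \<in> R"
  using assms unfolding congruence_def by blast+

lemma quot_cat_simps:
  assumes R: "congruence X R" and f: "f \<in> Arr X"
  shows "Obj (quot_cat X R) = Obj X" "Arr (quot_cat X R) = (\<lambda>f. R `` {f}) ` Arr X"
    "Dom (quot_cat X R) (R `` {f}) = Dom X f" "Cod (quot_cat X R) (R `` {f}) = Cod X f"
    "Ident (quot_cat X R) A = R `` {Ident X A}"
    "\<lbrakk>g \<in> Arr X; Cod X f = Dom X g\<rbrakk>
      \<Longrightarrow> Comp (quot_cat X R) (R `` {g}) (R `` {f}) = R `` {g \<cdot>\<^bsub>X\<^esub> f}"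
proof -
  note D = congruenceD[OF R]
  show "Obj (quot_cat X R) = Obj X" "Arr (quot_cat X R) = (\<lambda>f. R `` {f}) ` Arr X"
    "Ident (quot_cat X R) A = R `` {Ident X A}"
    by (auto simp: quot_cat_def quotient_def)
  have self: "h \<in> R `` {h}" if "h \<in> Arr X" for h
    using D(1) that by (rule equiv_class_self)
  show "Dom (quot_cat X R) (R `` {f}) = Dom X f"
    using the_elem_image_const[OF self[OF f], of "Dom X" "Dom X f"] D(2)[of f] by (simp add: quot_cat_def)
  show "Cod (quot_cat X R) (R `` {f}) = Cod X f"
    using the_elem_image_const[OF self[OF f], of "Cod X" "Cod X f"] D(3)[of f] by (simp add: quot_cat_def)
  assume g: "g \<in> Arr X" "Cod X f = Dom X g"
  \<comment> \<open>The composite in the quotient is defined as the \<open>R\<close>-image of this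
    set. By congruence \<open>?M\<close> lies in one class, and it contains the composite of
    \<open>g\<close> and \<open>f\<close>, so the image is the class of that composite.\<close>
  let ?M = "{g' \<cdot>\<^bsub>X\<^esub> f' | f' g'. f' \<in> R `` {f} \<and> g' \<in> R `` {g} \<and> Cod X f' = Dom X g'}"
  have M: "(g \<cdot>\<^bsub>X\<^esub> f, h) \<in> R" if "h \<in> ?M" for h
    using that D(4) g(2) by blast
  have "g \<cdot>\<^bsub>X\<^esub> f \<in> ?M"
    using self[OF f] self[OF g(1)] g(2) by blast
  moreover have "sym R" "trans R"
    using D(1) by (simp_all add: equiv_def)
  ultimately have "R `` ?M = R `` {g \<cdot>\<^bsub>X\<^esub> f}"
    using M by (blast dest: symD transD)
  then show "Comp (quot_cat X R) (R `` {g}) (R `` {f}) = R `` {g \<cdot>\<^bsub>X\<^esub> f}"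
    by (simp add: quot_cat_def)
qed

lemma (in category) is_functor_quot:
  assumes R: "congruence C R"
  shows "is_functor C (quot_cat C R) (\<lambda>A. A) (\<lambda>f. R `` {f})"
proof -
  note q = quot_cat_simps[OF R]
  have obj: "Obj (quot_cat C R) = Obj C"
    by (simp add: quot_cat_def)
  have idq: "Ident (quot_cat C R) A = R `` {Ident C A}" for A
    by (simp add: quot_cat_def)
  have arrE: "\<exists>f \<in> Arr C. K = R `` {f}" if "K \<in> Arr (quot_cat C R)" for K
    using that by (auto simp: quot_cat_def quotient_def)
  have arrI: "R `` {f} \<in> Arr (quot_cat C R)" if "f \<in> Arr C" for f
    using that by (auto simp: q(2))
  have "category (quot_cat C R)"
  proof
    fix K
    assume "K \<in> Arr (quot_cat C R)"
    then obtain f where f: "f \<in> Arr C" "K = R `` {f}"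
      using arrE by blast
    show "Dom (quot_cat C R) K \<in> Obj (quot_cat C R)" "Cod (quot_cat C R) K \<in> Obj (quot_cat C R)"
      using f by (simp_all add: q obj cat_simps)
    show "Comp (quot_cat C R) K (Ident (quot_cat C R) (Dom (quot_cat C R) K)) = K"
      "Comp (quot_cat C R) (Ident (quot_cat C R) (Cod (quot_cat C R) K)) K = K"
      using f by (simp_all add: q idq cat_simps Comp_Ident Ident_Comp)
  next
    fix A
    assume "A \<in> Obj (quot_cat C R)"
    then have "A \<in> Obj C"
      by (simp add: obj)
    then show "Ident (quot_cat C R) A \<in> Arr (quot_cat C R)"
      "Dom (quot_cat C R) (Ident (quot_cat C R) A) = A" "Cod (quot_cat C R) (Ident (quot_cat C R) A) = A"
      by (simp_all add: idq arrI q cat_simps)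
  next
    fix K L
    assume "K \<in> Arr (quot_cat C R)" "L \<in> Arr (quot_cat C R)" and KL: "Cod (quot_cat C R) K = Dom (quot_cat C R) L"
    then obtain f g where fg: "f \<in> Arr C" "K = R `` {f}" "g \<in> Arr C" "L = R `` {g}"
      using arrE by metis
    moreover have "Cod C f = Dom C g"
      using KL fg by (simp add: q)
    ultimately show "Comp (quot_cat C R) L K \<in> Arr (quot_cat C R)"
      "Dom (quot_cat C R) (Comp (quot_cat C R) L K) = Dom (quot_cat C R) K"
      "Cod (quot_cat C R) (Comp (quot_cat C R) L K) = Cod (quot_cat C R) L"
      by (simp_all add: q(3,4,6) arrI cat_simps)
  next
    fix K L M
    assume "K \<in> Arr (quot_cat C R)" "L \<in> Arr (quot_cat C R)" "M \<in> Arr (quot_cat C R)"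
      and KLM: "Cod (quot_cat C R) K = Dom (quot_cat C R) L" "Cod (quot_cat C R) L = Dom (quot_cat C R) M"
    then obtain f g h where fgh: "f \<in> Arr C" "K = R `` {f}" "g \<in> Arr C" "L = R `` {g}" "h \<in> Arr C" "M = R `` {h}"
      using arrE by metis
    moreover have "Cod C f = Dom C g" "Cod C g = Dom C h"
      using KLM fgh by (simp_all add: q)
    ultimately show "Comp (quot_cat C R) M (Comp (quot_cat C R) L K) =
        Comp (quot_cat C R) (Comp (quot_cat C R) M L) K"
      by (simp add: q(6) cat_simps Comp_assoc)
  qed
  then show ?thesis
    by (intro is_functor.intro is_functor_axioms.intro category_axioms) (simp_all add: obj idq arrI q)
qed

text \<open>As in the homomorphism theorem, \<open>Y\<close> is isomorphic to the quotient of
  \<open>X\<close> by the kernel of \<open>Qa\<close>.\<close>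

lemma quotient_category_if_surjective:
  assumes F: "is_functor X Y Qo Qa" and Qo: "bij_betw Qo (Obj X) (Obj Y)" and Qa: "Qa ` Arr X = Arr Y"
  shows "is_quotient_category X Y Qo Qa"
proof -
  interpret is_functor X Y Qo Qa by fact
  define R where "R = {(f, g). f \<in> Arr X \<and> g \<in> Arr X \<and> Dom X f = Dom X g \<and> Cod X f = Cod X g \<and> Qa f = Qa g}"
  \<comment> \<open>A congruence relates only parallel arrows; parallelism follows from
    \<open>Qa f = Qa g\<close> because \<open>Qo\<close> is injective on objects. Hence
    \<open>R\<close> is the full kernel of \<open>Qa\<close>, and the induced \<open>Ga\<close> is
    injective.\<close>
  have R_iff: "(f, g) \<in> R \<longleftrightarrow> Qa f = Qa g" if "f \<in> Arr X" "g \<in> Arr X" for f g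
  proof
    assume e: "Qa f = Qa g"
    have "Qo (Dom X f) = Qo (Dom X g)" "Qo (Cod X f) = Qo (Cod X g)"
      using e Fa_Dom Fa_Cod that by metis+
    then have "Dom X f = Dom X g" "Cod X f = Cod X g"
      using Qo that by (auto simp: bij_betw_def inj_on_def X.cat_simps)
    then show "(f, g) \<in> R"
      using that e by (simp add: R_def)
  qed (simp add: R_def)
  have eq: "equiv (Arr X) R"
    by (auto simp: equiv_def refl_on_def sym_def trans_def R_def)
  have R: "congruence X R"
    unfolding congruence_def using eq by (auto simp: R_def X.cat_simps Fa_Comp)
  define Ga where "Ga K = the_elem (Qa ` K)" for K
  have Ga: "Ga (R `` {f}) = Qa f" if "f \<in> Arr X" for f
    unfolding Ga_def using equiv_class_self[OF eq that]
    by (rule the_elem_image_const) (simp add: R_def)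
  interpret q: is_functor X "quot_cat X R" "\<lambda>A. A" "\<lambda>f. R `` {f}"
    using R by (rule X.is_functor_quot)
  note qs = quot_cat_simps[OF R]
  have obj: "Obj (quot_cat X R) = Obj X" and idq: "Ident (quot_cat X R) A = R `` {Ident X A}" for A
    by (simp_all add: quot_cat_def)
  have arr: "Arr (quot_cat X R) = (\<lambda>f. R `` {f}) ` Arr X"
    by (auto simp: quot_cat_def quotient_def)
  have "is_functor (quot_cat X R) Y Qo Ga"
  proof (intro is_functor.intro is_functor_axioms.intro q.Y.category_axioms Y.category_axioms)
    fix K L
    assume "K \<in> Arr (quot_cat X R)" "L \<in> Arr (quot_cat X R)" and KL: "Cod (quot_cat X R) K = Dom (quot_cat X R) L"
    then obtain f g where fg: "f \<in> Arr X" "K = R `` {f}" "g \<in> Arr X" "L = R `` {g}"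
      by (auto simp: arr)
    moreover have "Cod X f = Dom X g"
      using KL fg by (simp add: qs)
    ultimately show "Ga (Comp (quot_cat X R) L K) = Comp Y (Ga L) (Ga K)"
      by (simp add: qs(6) Ga X.cat_simps Fa_Comp)
  qed (auto simp: arr obj idq qs(3,4) Ga Fo_Obj Fa_Arr Fa_Dom Fa_Cod Fa_Ident X.cat_simps)
  moreover have "bij_betw Ga (Arr (quot_cat X R)) (Arr Y)"
  proof (rule bij_betw_imageI)
    show "inj_on Ga (Arr (quot_cat X R))"
      by (rule inj_onI) (auto simp only: arr Ga simp flip: R_iff intro!: equiv_class_eq[OF eq])
    show "Ga ` Arr (quot_cat X R) = Arr Y"
      unfolding arr Qa[symmetric] image_image using Ga by (intro image_cong) auto
  qed
  ultimately have "is_iso_functor (quot_cat X R) Y Qo Ga"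
    using Qo by (simp add: is_iso_functor_def obj)
  then show ?thesis
    unfolding is_quotient_category_def using R Ga by blast
qed

subsection \<open>The quotient of the category of spans by a compatible equivalence relation\<close>

context stable_class
begin

text \<open>The substantial point is that the union of all \<open>hcomp C q' p'\<close> over
  representatives is exactly one isomorphism class: compatibility gives one inclusion,
  \<open>hcomp_iso_closed\<close> the other.\<close>

lemma span_category_Span: "span_category C S (span_iso C S) (Span C S) (\<lambda>p. span_iso C S `` {p})"
proof (intro span_category.intro span_category_axioms.intro stable_class_axioms)
  note c = compatibleD[OF compatible_span_iso]
  have self: "p \<in> span_iso C S `` {p}" if "p \<in> spans C S" for p
    using equiv_span_iso that by (rule equiv_class_self)
  show "Arr (Span C S) = (\<lambda>p. span_iso C S `` {p}) ` spans C S"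
    by (auto simp: Span_def quotient_def)
  fix p
  assume p: "p \<in> spans C S"
  show "Dom (Span C S) (span_iso C S `` {p}) = src C p"
    using the_elem_image_const[OF self[OF p], of "src C" "src C p"] c(3)[of p] by (simp add: Span_def)
  show "Cod (Span C S) (span_iso C S `` {p}) = tgt C p"
    using the_elem_image_const[OF self[OF p], of "tgt C" "tgt C p"] c(4)[of p] by (simp add: Span_def)
  fix q
  assume q: "q \<in> spans C S"
  show "span_iso C S `` {p} = span_iso C S `` {q} \<longleftrightarrow> (p, q) \<in> span_iso C S"
    using equiv_span_iso p q by (rule eq_equiv_class_iff)
  fix r
  assume r: "r \<in> hcomp C q p"
  have tr: "trans (span_iso C S)" and sy: "sym (span_iso C S)"
    using equiv_span_iso by (simp_all add: equiv_def)
  have "(\<Union>p' \<in> span_iso C S `` {p}. \<Union>q' \<in> span_iso C S `` {q}. hcomp C q' p') = span_iso C S `` {r}"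
  proof (intro equalityI subsetI)
    fix x
    assume "x \<in> (\<Union>p' \<in> span_iso C S `` {p}. \<Union>q' \<in> span_iso C S `` {q}. hcomp C q' p')"
    then show "x \<in> span_iso C S `` {r}"
      using compatible_hcomp[OF compatible_span_iso tr _ _ r] by blast
  next
    fix x
    assume "x \<in> span_iso C S `` {r}"
    then have "x \<in> hcomp C q p"
      using hcomp_iso_closed[OF p q r] sy by (blast dest: symD)
    then show "x \<in> (\<Union>p' \<in> span_iso C S `` {p}. \<Union>q' \<in> span_iso C S `` {q}. hcomp C q' p')"
      using self[OF p] self[OF q] by blast
  qed
  then show "Comp (Span C S) (span_iso C S `` {q}) (span_iso C S `` {p}) = span_iso C S `` {r}"
    by (simp add: Span_def)
qed (simp_all add: Span_def)

text \<open>\<open>class_rel\<close> asks for some pair of related representatives; as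
  \<open>E\<close> is an equivalence relation containing the isomorphisms, any other pair is then
  related too.\<close>

lemma class_rel_iff:
  assumes E: "compatible C S E" "equiv (spans C S) E" and pq: "p \<in> spans C S" "q \<in> spans C S"
  shows "(span_iso C S `` {p}, span_iso C S `` {q}) \<in> class_rel C S E \<longleftrightarrow> (p, q) \<in> E"
proof -
  interpret span_category C S "span_iso C S" "Span C S" "\<lambda>p. span_iso C S `` {p}"
    by (rule span_category_Span)
  have I: "span_iso C S \<subseteq> E"
    by (rule compatibleD(5)[OF E(1)])
  have tr: "trans E" and sy: "sym E"
    using E(2) by (simp_all add: equiv_def)
  have "p \<in> span_iso C S `` {p}" "q \<in> span_iso C S `` {q}"
    using pq by - (rule equiv_class_self[OF equiv_span_iso], assumption)+
  then have "(p, q) \<in> E \<Longrightarrow> (span_iso C S `` {p}, span_iso C S `` {q}) \<in> class_rel C S E"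
    using cl_Arr[OF pq(1)] cl_Arr[OF pq(2)] by (auto simp: class_rel_def)
  moreover have "(p, q) \<in> E" if pq': "(span_iso C S `` {p}, span_iso C S `` {q}) \<in> class_rel C S E"
  proof -
    obtain p' q' where "(p, p') \<in> E" "(p', q') \<in> E" "(q, q') \<in> E"
      using pq' I unfolding class_rel_def by blast
    then show ?thesis
      using tr sy by (meson symD transD)
  qed
  ultimately show ?thesis
    by blast
qed

lemma congruence_class_rel:
  assumes E: "compatible C S E" "equiv (spans C S) E"
  shows "congruence (Span C S) (class_rel C S E)"
proof -
  interpret span_category C S "span_iso C S" "Span C S" "\<lambda>p. span_iso C S `` {p}"
    by (rule span_category_Span)
  note iff = class_rel_iff[OF E]
  have sub: "class_rel C S E \<subseteq> Arr (Span C S) \<times> Arr (Span C S)"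
    by (auto simp: class_rel_def)
  have clE: "\<exists>p q. K = span_iso C S `` {p} \<and> L = span_iso C S `` {q} \<and> p \<in> spans C S \<and> q \<in> spans C S \<and> (p, q) \<in> E"
    if KL: "(K, L) \<in> class_rel C S E" for K L
  proof -
    have "K \<in> Arr (Span C S)" "L \<in> Arr (Span C S)"
      using KL sub by blast+
    then obtain p q where "K = span_iso C S `` {p}" "L = span_iso C S `` {q}" "p \<in> spans C S" "q \<in> spans C S"
      unfolding Arr_Y by blast
    then show ?thesis
      using KL iff by blast
  qed
  have tr: "trans E" and sy: "sym E" and rf: "refl_on (spans C S) E"
    using E(2) by (simp_all add: equiv_def)
  have "equiv (Arr (Span C S)) (class_rel C S E)"
  proof (rule equivI)
    show "refl_on (Arr (Span C S)) (class_rel C S E)"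
      using rf by (auto simp: refl_on_def Arr_Y iff)
    show "sym (class_rel C S E)"
      using sy clE iff by (intro symI) (metis symD)
    show "trans (class_rel C S E)"
    proof (rule transI)
      fix K L M
      assume KL: "(K, L) \<in> class_rel C S E" and LM: "(L, M) \<in> class_rel C S E"
      obtain p q r where e: "K = span_iso C S `` {p}" "L = span_iso C S `` {q}" "M = span_iso C S `` {r}"
        and sp: "p \<in> spans C S" "q \<in> spans C S" "r \<in> spans C S"
        using KL LM sub unfolding Arr_Y by blast
      then have "(p, q) \<in> E" "(q, r) \<in> E"
        using KL LM iff by simp_all
      then have "(p, r) \<in> E"
        by (rule transD[OF tr])
      then show "(K, M) \<in> class_rel C S E"
        using e sp iff by simp
    qed
  qed (rule sub)
  moreover have "Dom (Span C S) K = Dom (Span C S) L \<and> Cod (Span C S) K = Cod (Span C S) L"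
    if KL: "(K, L) \<in> class_rel C S E" for K L
    using clE[OF KL] compatibleD(3,4)[OF E(1)] by (auto simp: Dom_Y Cod_Y)
  moreover have "(Comp (Span C S) L K, Comp (Span C S) L' K') \<in> class_rel C S E"
    if K: "(K, K') \<in> class_rel C S E" and L: "(L, L') \<in> class_rel C S E"
      and KL: "Cod (Span C S) K = Dom (Span C S) L" for K K' L L'
  proof -
    obtain p p' where p: "K = span_iso C S `` {p}" "K' = span_iso C S `` {p'}" "p \<in> spans C S" "p' \<in> spans C S" "(p, p') \<in> E"
      using clE[OF K] by blast
    obtain q q' where q: "L = span_iso C S `` {q}" "L' = span_iso C S `` {q'}" "q \<in> spans C S" "q' \<in> spans C S" "(q, q') \<in> E"
      using clE[OF L] by blast
    have "tgt C p = src C q"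
      using KL p q by (simp add: Dom_Y Cod_Y)
    moreover from this have "tgt C p' = src C q'"
      using compatibleD(3,4)[OF E(1)] p(5) q(5) by metis
    ultimately obtain r r' where r: "r \<in> hcomp C q p" "r' \<in> hcomp C q' p'"
      using hcomp_exists p q by metis
    then have "(r, r') \<in> E"
      using compatible_hcomp[OF E(1) tr p(5) q(5)] by blast
    moreover have "r \<in> spans C S" "r' \<in> spans C S"
      using hcomp_spans(1) r p q by blast+
    ultimately show ?thesis
      using r p q by (simp add: Comp_Y iff)
  qed
  ultimately show ?thesis
    unfolding congruence_def by auto
qed

lemma span_category_span_quot:
  assumes E: "compatible C S E" "equiv (spans C S) E"
  shows "span_category C S E (span_quot C S E) (span_class C S E)"
proof -
  interpret sp: span_category C S "span_iso C S" "Span C S" "\<lambda>p. span_iso C S `` {p}"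
    by (rule span_category_Span)
  note qs = quot_cat_simps[OF congruence_class_rel[OF E] sp.cl_Arr]
  show ?thesis
  proof (intro span_category.intro span_category_axioms.intro stable_class_axioms)
    show "Obj (span_quot C S E) = Obj C"
      by (simp add: span_quot_def quot_cat_def sp.Obj_Y)
    show "Arr (span_quot C S E) = span_class C S E ` spans C S"
      by (auto simp: span_quot_def quot_cat_def quotient_def sp.Arr_Y span_class_def)
    show "Ident (span_quot C S E) A = span_class C S E (Ident C A, Ident C A)" if "A \<in> Obj C" for A
      using that by (simp add: span_quot_def quot_cat_def sp.Ident_Y span_class_def)
    fix p
    assume p: "p \<in> spans C S"
    show "Dom (span_quot C S E) (span_class C S E p) = src C p"
      "Cod (span_quot C S E) (span_class C S E p) = tgt C p"
      using p by (simp_all add: span_quot_def span_class_def qs sp.Dom_Y sp.Cod_Y)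
    fix q
    assume q: "q \<in> spans C S"
    show "span_class C S E p = span_class C S E q \<longleftrightarrow> (p, q) \<in> E"
      using eq_equiv_class_iff[OF congruenceD(1)[OF congruence_class_rel[OF E]] sp.cl_Arr[OF p] sp.cl_Arr[OF q]]
        class_rel_iff[OF E p q] by (simp add: span_class_def)
    fix r
    assume r: "r \<in> hcomp C q p"
    show "Comp (span_quot C S E) (span_class C S E q) (span_class C S E p) = span_class C S E r"
      using qs(6)[OF p sp.cl_Arr[OF q]] hcomp_spans(4)[OF p q r] p q
      by (simp add: span_quot_def span_class_def sp.Comp_Y[OF p q r] sp.Dom_Y sp.Cod_Y)
  qed
qed

text \<open>An \<open>E\<close>-class sits inside a single class of the coarser \<open>E'\<close>,
  so its image is that class. This evaluates \<open>Sect_to_Par\<close> and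
  \<open>Sect_to_Retr\<close> on representatives.\<close>

lemma class_rel_span_class:
  assumes E: "compatible C S E" "equiv (spans C S) E" and E': "compatible C S E'" "equiv (spans C S) E'"
    and "E \<subseteq> E'" and p: "p \<in> spans C S"
  shows "class_rel C S E' `` span_class C S E p = span_class C S E' p"
proof -
  interpret span_category C S "span_iso C S" "Span C S" "\<lambda>p. span_iso C S `` {p}"
    by (rule span_category_Span)
  have "class_rel C S E \<subseteq> class_rel C S E'"
    using \<open>E \<subseteq> E'\<close> by (auto simp: class_rel_def)
  moreover have "(span_iso C S `` {p}, span_iso C S `` {p}) \<in> class_rel C S E"
    using class_rel_iff[OF E p p] compatible_refl[OF E(1) p] by simp
  moreover have "trans (class_rel C S E')"
    using congruenceD(1)[OF congruence_class_rel[OF E']] by (simp add: equiv_def)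
  ultimately show ?thesis
    unfolding span_class_def by (blast dest: transD)
qed

end

section \<open>The relations \<open>sim_a\<close>, \<open>sim_zstar\<close> and \<open>sim_z\<close>\<close>

context stable_class
begin

section \<open>The class \<open>S_star\<close>\<close>

lemma Ident_span_mor: "x \<in> Arr C \<Longrightarrow> span_mor C (x, x) (Ident C (Cod C x), Ident C (Cod C x)) x"
  by (simp add: span_mor_def cat_simps Ident_Comp)

text \<open>Every morphism is a pullback of itself along the identity of its codomain.\<close>

lemma conjugate_S_star:
  assumes "is_conjugate C S w"
  shows "w \<in> S_star C S"
proof -
  have "w \<in> Arr C"
    using assms by (auto simp: is_conjugate_def span_mor_def)
  then have "is_pullback C (Ident C (Cod C w)) w w (Ident C (Dom C w))"
    by (intro pullback_flip[OF pullback_Ident])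
  then show ?thesis
    using assms unfolding S_star_def by blast
qed

text \<open>A pullback of a pullback of a conjugate is again a pullback of that conjugate, by
  pasting.\<close>

lemma S_star_pullback:
  assumes "w \<in> S_star C S" "is_pullback C h w x h'"
  shows "x \<in> S_star C S"
proof -
  obtain v k k' where "is_conjugate C S v" "is_pullback C k v w k'"
    using assms(1) unfolding S_star_def by blast
  then show ?thesis
    using pullback_paste[OF _ assms(2)] unfolding S_star_def by blast
qed

text \<open>An identity is a conjugate of the identity morphism of an identity cospan, and an
  isomorphism is a pullback of the identity on its codomain.\<close>

lemma S_star_iso:
  assumes x: "is_iso C x"
  shows "x \<in> S_star C S"
proof -
  have xa: "x \<in> Arr C"
    using x by (simp add: is_iso_def)
  define i where "i = Ident C (Cod C x)"
  have i: "i \<in> Arr C" "i \<in> S" "Dom C i = Cod C x" "Cod C i = Cod C x" "i \<cdot> i = i"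
    using xa by (simp_all add: i_def cat_simps Ident_S Ident_Comp')
  have "is_pullback C i i i i"
    using pullback_Ident[of i] i by (simp add: i_def cat_simps)
  then have "is_conjugate C S i"
    using i unfolding is_conjugate_def
    by (intro bexI[of _ "(i, i)"] bexI[of _ i] conjI)
      (simp_all add: cospans_def cospan_mor_def span_mor_def)
  moreover have "is_pullback C i i x x"
    using x xa i by (intro pullback_of_isos) (simp_all add: i_def iso_Ident cat_simps)
  ultimately show ?thesis
    unfolding S_star_def by blast
qed

text \<open>A conjugate \<open>w\<close> satisfies \<open>fst q \<cdot> w = fst p\<close>, and both
  legs lie in \<open>S\<close> as pullbacks of \<open>S\<close>-morphisms, so weak left cancellation
  puts \<open>w\<close> in \<open>S\<close>; stability then covers its pullbacks.\<close>

lemma S_star_subset: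
  assumes "weakly_left_cancellable C S"
  shows "S_star C S \<subseteq> S"
proof
  fix x
  assume "x \<in> S_star C S"
  then obtain w h h' where w: "is_conjugate C S w" and P: "is_pullback C h w x h'"
    unfolding S_star_def by blast
  obtain c d p q where cd: "c \<in> cospans C S" "d \<in> cospans C S" "p \<in> pb C c" "q \<in> pb C d" "span_mor C p q w"
    using w unfolding is_conjugate_def by blast
  obtain f s g t where e: "c = (f, s)" "d = (g, t)"
    by (cases c, cases d) blast
  have "fst p \<in> S" "fst q \<in> S"
    using cd(1-4) S_pullback_closed by (auto simp: e cospans_def)
  then have "w \<in> S"
    using assms cd(5) by (auto simp: weakly_left_cancellable_def span_mor_def)
  then show "x \<in> S"
    using P by (rule S_pullback_closed)
qed

section \<open>The relation \<open>approx_a\<close> and conjugates\<close>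

lemma compatible_approx_a: "compatible C S (approx_a C S)"
proof -
  \<comment> \<open>Parallelism is a compatible relation that also relates the pullbacks of
    comparable cospans. Its membership in the family intersected by \<open>approx_a\<close> shows
    that \<open>approx_a\<close> relates only parallel spans.\<close>
  let ?T = "{(p, q). p \<in> spans C S \<and> q \<in> spans C S \<and> src C p = src C q \<and> tgt C p = tgt C q}"
  let ?P = "\<lambda>R. \<forall>c \<in> cospans C S. \<forall>d \<in> cospans C S. (\<exists>v \<in> S. cospan_mor C c d v) \<longrightarrow> pb C c \<times> pb C d \<subseteq> R"
  have "compatible C S ?T"
  proof (rule compatibleI)
    show "span_iso C S \<subseteq> ?T"
      using compatibleD(1-4)[OF compatible_span_iso] by blast
    fix p q r a b
    assume "(p, q) \<in> ?T" and r: "r \<in> spans C S"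
    then have sp: "p \<in> spans C S" "q \<in> spans C S" "src C p = src C q" "tgt C p = tgt C q"
      by simp_all
    show "(a, b) \<in> ?T" if "a \<in> hcomp C r p" "b \<in> hcomp C r q"
      using hcomp_spans[OF sp(1) r that(1)] hcomp_spans[OF sp(2) r that(2)] sp(3) by simp
    show "(a, b) \<in> ?T" if "a \<in> hcomp C p r" "b \<in> hcomp C q r"
      using hcomp_spans[OF r sp(1) that(1)] hcomp_spans[OF r sp(2) that(2)] sp(4) by simp
  qed simp
  moreover have "?P ?T"
  proof (intro ballI impI subsetI)
    fix c d pq
    assume cd: "c \<in> cospans C S" "d \<in> cospans C S" "\<exists>v \<in> S. cospan_mor C c d v" "pq \<in> pb C c \<times> pb C d"
    obtain f s g t where e: "c = (f, s)" "d = (g, t)"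
      by (cases c, cases d) blast
    obtain s' f' t' g' where pq: "pq = ((s', f'), (t', g'))" and P: "is_pullback C f s s' f'" and Q: "is_pullback C g t t' g'"
      using cd(4) by (auto simp: e)
    have st: "s \<in> S" "t \<in> S"
      using cd(1,2) by (auto simp: e cospans_def)
    have "s' \<in> S" "t' \<in> S"
      using S_pullback_closed[OF st(1) P] S_pullback_closed[OF st(2) Q] by blast+
    moreover obtain v where v: "v \<in> Arr C" "Dom C v = Cod C f" "v \<cdot> f = g" "v \<cdot> s = t"
      using cd(3) by (auto simp: e cospan_mor_def)
    moreover have "Dom C (v \<cdot> f) = Dom C f" "Dom C (v \<cdot> s) = Dom C s"
      using v(1,2) pullbackD[OF P] by (simp_all add: cat_simps)
    ultimately show "pq \<in> ?T"
      using pullbackD[OF P] pullbackD[OF Q] by (simp add: pq spans_iff src_tgt)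
  qed
  ultimately have ne: "compatible C S ?T \<and> ?P ?T"
    by blast
  have sub: "approx_a C S \<subseteq> ?T"
    unfolding approx_a_def using ne by (intro Inter_lower) simp
  show ?thesis
  proof (rule compatibleI)
    show "span_iso C S \<subseteq> approx_a C S"
      unfolding approx_a_def using compatibleD(5) by blast
    fix p q r a b
    assume *: "(p, q) \<in> approx_a C S" "r \<in> spans C S"
    then have "(p, q) \<in> R" if "compatible C S R" "?P R" for R
      using that unfolding approx_a_def by blast
    note ** = compatibleD(6)[OF _ this *(2)] compatibleD(7)[OF _ this *(2)]
    show "(a, b) \<in> approx_a C S" if "a \<in> hcomp C r p" "b \<in> hcomp C r q"
      using that unfolding approx_a_def by (auto intro: **)
    show "(a, b) \<in> approx_a C S" if "a \<in> hcomp C p r" "b \<in> hcomp C q r"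
      using that unfolding approx_a_def by (auto intro: **)
  qed (use sub in blast)
qed

lemma approx_a_pb:
  assumes "c \<in> cospans C S" "d \<in> cospans C S" "v \<in> S" "cospan_mor C c d v" "p \<in> pb C c" "q \<in> pb C d"
  shows "(p, q) \<in> approx_a C S"
  using assms unfolding approx_a_def by blast

lemma approx_a_subset:
  assumes "compatible C S R"
    and "\<And>c d v p q. \<lbrakk>c \<in> cospans C S; d \<in> cospans C S; v \<in> S; cospan_mor C c d v; p \<in> pb C c; q \<in> pb C d\<rbrakk>
      \<Longrightarrow> (p, q) \<in> R"
  shows "approx_a C S \<subseteq> R"
  unfolding approx_a_def using assms by (intro Inter_lower) blast

text \<open>Composing with \<open>v\<close> turns the square
  \<open>f \<cdot> s' = s \<cdot> f'\<close> into a cone over \<open>(g, t)\<close>, and the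
  universal property of the second pullback yields the conjugate.\<close>

lemma cospan_mor_conjugate:
  assumes cd: "c \<in> cospans C S" "d \<in> cospans C S" and v: "v \<in> S" "cospan_mor C c d v"
    and pq: "p \<in> pb C c" "q \<in> pb C d"
  obtains w where "is_conjugate C S w" "span_mor C p q w"
proof -
  obtain f s g t where e: "c = (f, s)" "d = (g, t)"
    by (cases c, cases d) blast
  obtain s' f' t' g' where p: "p = (s', f')" and q: "q = (t', g')"
    and P: "is_pullback C f s s' f'" and Q: "is_pullback C g t t' g'"
    using pq by (auto simp: e)
  note d = pullbackD[OF P]
  have v': "v \<in> Arr C" "Dom C v = Cod C f" "v \<cdot> f = g" "v \<cdot> s = t"
    using v(2) by (auto simp: e cospan_mor_def)
  have "(v \<cdot> f) \<cdot> s' = v \<cdot> (f \<cdot> s')"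
    using v'(1,2) d(1-8) by (simp add: Comp_assoc)
  also have "\<dots> = (v \<cdot> s) \<cdot> f'"
    using v'(1,2) d(1-8) by (simp add: d(9) Comp_assoc)
  finally have "g \<cdot> s' = t \<cdot> f'"
    by (simp only: v'(3,4))
  moreover have "Dom C f = Dom C g" "Dom C s = Dom C t"
    using Dom_Comp[of f v] Dom_Comp[of s v] v' d(1-8) by simp_all
  ultimately obtain w where "w \<in> Arr C" "Dom C w = Dom C s'" "Cod C w = Dom C t'" "t' \<cdot> w = s'" "g' \<cdot> w = f'"
    using pullback_lift[OF Q, of s' f'] d(1-8) by auto
  then have "span_mor C p q w"
    by (simp add: p q span_mor_def)
  then show ?thesis
    using that cd v pq unfolding is_conjugate_def by blast
qed

lemma compatible_S_star: "compatible C S (span_rel C S (\<lambda>x. x \<in> S_star C S))"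
  by (rule compatible_span_rel) (auto intro: S_star_pullback S_star_iso)

lemma compatible_S: "compatible C S (span_rel C S (\<lambda>x. x \<in> S))"
  by (rule compatible_span_rel) (auto intro: S_iso S_pullback_closed)

text \<open>By minimality of \<open>approx_a\<close> among compatible relations it suffices to treat
  its generating pairs, and these are linked by conjugates.\<close>

lemma approx_a_subset_S_star: "approx_a C S \<subseteq> span_rel C S (\<lambda>x. x \<in> S_star C S)"
proof (rule approx_a_subset[OF compatible_S_star])
  fix c d v p q
  assume *: "c \<in> cospans C S" "d \<in> cospans C S" "v \<in> S" "cospan_mor C c d v" "p \<in> pb C c" "q \<in> pb C d"
  then obtain w where "is_conjugate C S w" "span_mor C p q w"
    by (rule cospan_mor_conjugate)
  moreover have "p \<in> spans C S" "q \<in> spans C S"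
    using compatibleD(1,2)[OF compatible_approx_a approx_a_pb[OF *]] .
  ultimately show "(p, q) \<in> span_rel C S (\<lambda>x. x \<in> S_star C S)"
    unfolding span_rel_def using conjugate_S_star by blast
qed

section \<open>The three equivalence relations and their inclusions\<close>

lemma compatible_sims:
  "compatible C S (sim_a C S)" "compatible C S (sim_zstar C S)" "compatible C S (sim_z C S)"
  unfolding sim_a_def sim_zstar_def sim_z_def
  by (intro compatible_equiv_closure compatible_approx_a compatible_S_star compatible_S)+

lemma equiv_sims:
  "equiv (spans C S) (sim_a C S)" "equiv (spans C S) (sim_zstar C S)" "equiv (spans C S) (sim_z C S)"
proof -
  have "R \<subseteq> spans C S \<times> spans C S" if "compatible C S R" for R
    using compatibleD(1,2)[OF that] by auto
  note this[OF compatible_approx_a] this[OF compatible_S_star] this[OF compatible_S]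
  then show "equiv (spans C S) (sim_a C S)" "equiv (spans C S) (sim_zstar C S)" "equiv (spans C S) (sim_z C S)"
    unfolding sim_a_def sim_zstar_def sim_z_def by (blast intro: equiv_closure_equiv)+
qed

lemma approx_a_sim_a: "approx_a C S \<subseteq> sim_a C S"
  unfolding sim_a_def by (rule equiv_closure_incl)

lemma sim_a_sim_zstar: "sim_a C S \<subseteq> sim_zstar C S"
  unfolding sim_a_def
  by (rule equiv_closure_least[OF equiv_sims(2)])
    (use approx_a_subset_S_star equiv_closure_incl in \<open>unfold sim_zstar_def, blast\<close>)

lemma sim_zstar_sim_z:
  assumes "S_star C S \<subseteq> S"
  shows "sim_zstar C S \<subseteq> sim_z C S"
proof -
  have "span_rel C S (\<lambda>x. x \<in> S_star C S) \<subseteq> span_rel C S (\<lambda>x. x \<in> S)"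
    using assms by (auto simp: span_rel_def)
  also have "\<dots> \<subseteq> sim_z C S"
    unfolding sim_z_def by (rule equiv_closure_incl)
  finally show ?thesis
    unfolding sim_zstar_def by (rule equiv_closure_least[OF equiv_sims(3)])
qed

text \<open>The witness is \<open>x\<close> itself. This generator identifies the idempotent
  \<open>[x, x]\<close> with an identity and so makes \<open>[1, x]\<close> and
  \<open>[x, 1]\<close> mutually inverse.\<close>

lemma span_rel_Ident:
  assumes "x \<in> S" "P x"
  shows "((x, x), (Ident C (Cod C x), Ident C (Cod C x))) \<in> span_rel C S P"
  using assms Ident_span_mor[OF S_ArrD] unfolding span_rel_def
  by (auto simp: spans_iff S_ArrD Ident_S cat_simps)

lemmas span_category_Sect = span_category_span_quot[OF compatible_sims(1) equiv_sims(1), folded Sect_def]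
lemmas span_category_Par = span_category_span_quot[OF compatible_sims(2) equiv_sims(2), folded Par_def]
lemmas span_category_Retr = span_category_span_quot[OF compatible_sims(3) equiv_sims(3), folded Retr_def]

end

section \<open>The arrows \<open>[1, s]\<close> and \<open>[s, 1]\<close> in quotients of the
  category of spans\<close>

context span_category
begin

text \<open>Since \<open>s\<close> is a morphism of cospans from the identity cospan to \<open>(s, s)\<close>, the kernel pair of
  \<open>s\<close> is identified with the identity span.\<close>

lemma Comp_retraction:
  assumes "approx_a C S \<subseteq> E" and s: "s \<in> S"
  shows "Comp Y (cl (s, Ident C (Dom C s))) (cl (Ident C (Dom C s), s)) = Ident Y (Dom C s)"
proof -
  define i where "i = Ident C (Dom C s)"
  have sa: "s \<in> Arr C"
    using s by (rule S_ArrD)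
  have i: "i \<in> Arr C" "i \<in> S" "Dom C i = Dom C s" "Cod C i = Dom C s" "s \<cdot> i = s"
    using sa by (simp_all add: i_def cat_simps Ident_S Comp_Ident)
  obtain a b where P: "is_pullback C s s a b"
    using S_pullback_exists[OF s sa] by blast
  note d = pullbackD[OF P]
  have "is_pullback C i i i i"
    using pullback_Ident[of i] i by (simp add: i_def cat_simps)
  then have "((i, i), (a, b)) \<in> approx_a C S"
    using P s i sa by (intro approx_a_pb[of "(i, i)" "(s, s)" s]) (simp_all add: cospans_def cospan_mor_def)
  then have "((i, i), (a, b)) \<in> E"
    using assms(1) by blast
  have ii: "(i, i) \<in> spans C S" and si: "(s, i) \<in> spans C S" "(i, s) \<in> spans C S"
    using i s sa by (simp_all add: spans_iff)
  \<comment> \<open>The kernel pair of \<open>s\<close> is also the horizontal composite of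
    \<open>(s, i)\<close> after \<open>(i, s)\<close>, so the relation just found evaluates this
    composite.\<close>
  have "(i \<cdot> a, i \<cdot> b) \<in> hcomp C (s, i) (i, s)"
    using P by (rule hcompI)
  moreover have "i \<cdot> a = a" "i \<cdot> b = b"
    using d by (simp_all add: i_def Ident_Comp')
  ultimately have ab: "(a, b) \<in> hcomp C (s, i) (i, s)"
    by metis
  have "cl (i, i) = cl (a, b)"
    using cl_eq[OF ii hcomp_spans(1)[OF si(2,1) ab]] \<open>((i, i), (a, b)) \<in> E\<close> by simp
  then show ?thesis
    using Comp_Y[OF si(2,1) ab] sa by (simp add: Ident_Y cat_simps i_def)
qed

lemma Comp_section:
  assumes "x \<in> S"
  shows "Comp Y (cl (Ident C (Dom C x), x)) (cl (x, Ident C (Dom C x))) = cl (x, x)"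
  using assms cl_factor[of x x] by (simp add: spans_iff S_ArrD)

text \<open>One composite of \<open>[1, x]\<close> with \<open>[x, 1]\<close> is an identity by
  \<open>Comp_retraction\<close>; the other is the class of \<open>(x, x)\<close>, which is an
  identity by the third assumption.\<close>

lemma is_iso_unit:
  assumes "approx_a C S \<subseteq> E" and x: "x \<in> S"
    and "((x, x), (Ident C (Cod C x), Ident C (Cod C x))) \<in> E"
  shows "is_iso Y (cl (Ident C (Dom C x), x))"
proof -
  have xa: "x \<in> Arr C"
    using x by (rule S_ArrD)
  have sp: "(Ident C (Dom C x), x) \<in> spans C S" "(x, Ident C (Dom C x)) \<in> spans C S" "(x, x) \<in> spans C S"
    using x xa by (simp_all add: spans_iff cat_simps Ident_S)
  have "cl (x, x) = Ident Y (Cod C x)"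
    using cl_eq[OF sp(3) Ident_spans] assms(3) xa by (simp add: Ident_Y cat_simps)
  then show ?thesis
    unfolding is_iso_def using sp xa Comp_retraction[OF assms(1) x] Comp_section[OF x]
    by (intro conjI bexI[of _ "cl (x, Ident C (Dom C x))"])
      (simp_all add: cl_Arr Dom_Y Cod_Y src_tgt cat_simps)
qed

text \<open>Cancels \<open>[1, s]\<close> against the factor \<open>[s, 1]\<close> of
  \<open>cl_factor\<close>. A functor inverting the units on \<open>S\<close> is thereby forced on
  \<open>[s, f]\<close> by its values on units, which gives uniqueness of factorizations through
  \<open>Retr\<close>.\<close>

lemma Comp_unit:
  assumes "approx_a C S \<subseteq> E" and sf: "(s, f) \<in> spans C S"
  shows "Comp Y (cl (s, f)) (cl (Ident C (Dom C s), s)) = cl (Ident C (Dom C f), f)"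
proof -
  interpret Y: category Y
    by (rule category_Y)
  have m: "s \<in> S" "s \<in> Arr C" "f \<in> Arr C" "Dom C s = Dom C f"
    using sf by (auto simp: spans_iff S_ArrD)
  have sp: "(Ident C (Dom C f), f) \<in> spans C S" "(s, Ident C (Dom C s)) \<in> spans C S" "(Ident C (Dom C s), s) \<in> spans C S"
    using m by (simp_all add: spans_iff cat_simps Ident_S)
  have "Comp Y (cl (s, f)) (cl (Ident C (Dom C s), s)) =
      Comp Y (Comp Y (cl (Ident C (Dom C f), f)) (cl (s, Ident C (Dom C s)))) (cl (Ident C (Dom C s), s))"
    by (simp only: cl_factor[OF sf])
  also have "\<dots> = Comp Y (cl (Ident C (Dom C f), f))
      (Comp Y (cl (s, Ident C (Dom C s))) (cl (Ident C (Dom C s), s)))"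
    using sp m by (intro Y.Comp_assoc[symmetric]) (simp_all add: cl_Arr Dom_Y Cod_Y src_tgt cat_simps)
  also have "\<dots> = cl (Ident C (Dom C f), f)"
    unfolding Comp_retraction[OF assms(1) m(1)]
    using sp m by (simp add: Y.Comp_Ident' cl_Arr Dom_Y src_tgt cat_simps)
  finally show ?thesis .
qed

end

section \<open>The localizations\<close>

context stable_class
begin

section \<open>Comparison functors between quotients of the category of spans\<close>

lemma is_functor_class_rel:
  assumes E: "compatible C S E" "equiv (spans C S) E" and E': "compatible C S E'" "equiv (spans C S) E'"
    and "E \<subseteq> E'"
  shows "is_functor (span_quot C S E) (span_quot C S E') (\<lambda>A. A) (\<lambda>K. class_rel C S E' `` K)"
    and "(\<lambda>K. class_rel C S E' `` K) ` Arr (span_quot C S E) = Arr (span_quot C S E')"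
proof -
  interpret e: span_category C S E "span_quot C S E" "span_class C S E"
    by (rule span_category_span_quot[OF E])
  interpret e': span_category C S E' "span_quot C S E'" "span_class C S E'"
    by (rule span_category_span_quot[OF E'])
  note cls = class_rel_span_class[OF assms]
  show "is_functor (span_quot C S E) (span_quot C S E') (\<lambda>A. A) (\<lambda>K. class_rel C S E' `` K)"
  proof (rule e.is_functor_Y[OF e'.category_Y])
    fix p q r
    assume *: "p \<in> spans C S" "q \<in> spans C S" "r \<in> hcomp C q p"
    then show "class_rel C S E' `` span_class C S E r =
        Comp (span_quot C S E') (class_rel C S E' `` span_class C S E q) (class_rel C S E' `` span_class C S E p)"
      by (simp only: cls hcomp_spans(1)[OF *] e'.Comp_Y)
  qed (simp_all add: cls e'.Obj_Y e'.cl_Arr e'.Dom_Y e'.Cod_Y e'.Ident_Y e.Ident_spans)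
  show "(\<lambda>K. class_rel C S E' `` K) ` Arr (span_quot C S E) = Arr (span_quot C S E')"
    unfolding e.Arr_Y e'.Arr_Y image_image by (rule image_cong) (simp_all add: cls)
qed

text \<open>The inclusion of \<open>sim_a\<close> in \<open>sim_z\<close> goes through
  \<open>sim_zstar\<close> by way of \<open>S_star C S \<subseteq> S\<close>; the induced functor is
  the identity on objects and surjective on arrows, so the kernel criterion applies.\<close>

lemma Retr_quotient_of_Sect:
  assumes "S_star C S \<subseteq> S"
  shows "is_quotient_category (Sect C S) (Retr C S) (\<lambda>A. A) (Sect_to_Retr C S)"
proof -
  have "Sect_to_Retr C S = (\<lambda>K. class_rel C S (sim_z C S) `` K)"
    by (simp add: fun_eq_iff Sect_to_Retr_def)
  moreover have "sim_a C S \<subseteq> sim_z C S"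
    using sim_a_sim_zstar sim_zstar_sim_z[OF assms] by blast
  note is_functor_class_rel[OF compatible_sims(1) equiv_sims(1) compatible_sims(3) equiv_sims(3) this]
  moreover have "Obj (Retr C S) = Obj (Sect C S)"
    using span_category.Obj_Y[OF span_category_Sect] span_category.Obj_Y[OF span_category_Retr] by simp
  ultimately show ?thesis
    by (intro quotient_category_if_surjective) (simp_all add: Sect_def Retr_def bij_betw_def)
qed

section \<open>\<open>Par\<close> as a localization of \<open>Sect\<close>\<close>

lemma Par_localization_of_Sect:
  assumes "S_star C S \<subseteq> S"
  shows "is_category_of_fractions TYPE('p) TYPE('b) (Sect C S) (Phi_a C S ` S_star C S)
    (Par C S) (\<lambda>A. A) (Sect_to_Par C S)"
proof -
  interpret a: span_category C S "sim_a C S" "Sect C S" "span_class C S (sim_a C S)"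
    by (rule span_category_Sect)
  interpret z: span_category C S "sim_zstar C S" "Par C S" "span_class C S (sim_zstar C S)"
    by (rule span_category_Par)
  let ?a = "span_class C S (sim_a C S)" and ?z = "span_class C S (sim_zstar C S)"
  have Q: "Sect_to_Par C S (?a p) = ?z p" if "p \<in> spans C S" for p
    using class_rel_span_class[OF compatible_sims(1) equiv_sims(1) compatible_sims(2) equiv_sims(2) sim_a_sim_zstar that]
    by (simp add: Sect_to_Par_def)
  have "Sect_to_Par C S = (\<lambda>K. class_rel C S (sim_zstar C S) `` K)"
    by (simp add: fun_eq_iff Sect_to_Par_def)
  then have Q_functor: "is_functor (Sect C S) (Par C S) (\<lambda>A. A) (Sect_to_Par C S)"
    using is_functor_class_rel(1)[OF compatible_sims(1) equiv_sims(1) compatible_sims(2) equiv_sims(2) sim_a_sim_zstar]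
    by (simp add: Sect_def Par_def)
  have unit: "(Ident C (Dom C f), f) \<in> spans C S" if "f \<in> Arr C" for f
    using that by (simp add: spans_iff Ident_S cat_simps)
  have approx: "approx_a C S \<subseteq> sim_zstar C S"
    using approx_a_sim_a sim_a_sim_zstar by blast
  \<comment> \<open>By hypothesis \<open>x\<close> is in \<open>S\<close>, so \<open>(x, x)\<close>
    is an \<open>S\<close>-span; its pair with the identity span is a generator of
    \<open>sim_zstar\<close>.\<close>
  have iso: "is_iso (Par C S) (Sect_to_Par C S (Phi_a C S x))" if x: "x \<in> S_star C S" for x
  proof -
    have xS: "x \<in> S"
      using x assms by blast
    have "((x, x), (Ident C (Cod C x), Ident C (Cod C x))) \<in> sim_zstar C S"
      using span_rel_Ident[of x "\<lambda>x. x \<in> S_star C S", OF xS x] equiv_closure_incl unfolding sim_zstar_def by blast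
    then have "is_iso (Par C S) (?z (Ident C (Dom C x), x))"
      by (rule z.is_iso_unit[OF approx xS])
    then show ?thesis
      by (simp add: Phi_a_def Q unit xS S_ArrD)
  qed
  have "\<exists>Go Ga. factors_through (Sect C S) (Par C S) (\<lambda>A. A) (Sect_to_Par C S) D Fo Fa Go Ga \<and>
      (\<forall>Go' Ga'. factors_through (Sect C S) (Par C S) (\<lambda>A. A) (Sect_to_Par C S) D Fo Fa Go' Ga' \<longrightarrow>
        (\<forall>A \<in> Obj (Par C S). Go' A = Go A) \<and> (\<forall>f \<in> Arr (Par C S). Ga' f = Ga f))"
    if F: "is_functor (Sect C S) D Fo Fa" and inv: "\<forall>x \<in> Phi_a C S ` S_star C S. is_iso D (Fa x)"
    for D :: "('p, 'b) cat" and Fo Fa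
  proof -
    interpret F: is_functor "Sect C S" D Fo Fa
      by (rule F)
    \<comment> \<open>In \<open>Sect\<close> the arrow \<open>[x, 1]\<close> is already a left
      inverse of \<open>[1, x]\<close>. Once the functor makes \<open>[1, x]\<close> invertible,
      this inverse is two-sided, so the idempotent \<open>[x, x]\<close> is sent to an
      identity.\<close>
    have F_idem: "Fa (?a (x, x)) = Ident D (Fo (Cod C x))" if x: "x \<in> S_star C S" for x
    proof -
      have xS: "x \<in> S" and xa: "x \<in> Arr C"
        using x assms S_ArrD by auto
      let ?u = "?a (Ident C (Dom C x), x)" and ?v = "?a (x, Ident C (Dom C x))"
      have sp: "(Ident C (Dom C x), x) \<in> spans C S" "(x, Ident C (Dom C x)) \<in> spans C S"
        using xS xa by (simp_all add: spans_iff cat_simps Ident_S)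
      note uv = a.cl_Arr[OF sp(1)] a.cl_Arr[OF sp(2)]
      have dc: "Dom (Sect C S) ?u = Dom C x" "Cod (Sect C S) ?u = Cod C x"
        "Dom (Sect C S) ?v = Cod C x" "Cod (Sect C S) ?v = Dom C x"
        using sp xa by (simp_all add: a.Dom_Y a.Cod_Y src_tgt cat_simps)
      note D = F.Fa_Arr[OF uv(1)] F.Fa_Arr[OF uv(2)] F.Fa_Dom[OF uv(1)] F.Fa_Dom[OF uv(2)]
        F.Fa_Cod[OF uv(1)] F.Fa_Cod[OF uv(2)]
      have obj: "Dom C x \<in> Obj (Sect C S)" "Cod C x \<in> Obj (Sect C S)"
        using xa by (simp_all add: a.Obj_Y cat_simps)
      have vu: "Comp D (Fa ?v) (Fa ?u) = Ident D (Fo (Dom C x))"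
        using F.Fa_Comp[OF uv(1,2)] a.Comp_retraction[OF approx_a_sim_a xS] obj dc by (simp add: F.Fa_Ident)
      have xx: "Fa (?a (x, x)) = Comp D (Fa ?u) (Fa ?v)"
        using F.Fa_Comp[OF uv(2,1)] a.Comp_section[OF xS] dc by simp
      have iso_u: "is_iso D (Fa ?u)"
        using inv x by (auto simp: Phi_a_def)
      have eq: "Comp D (Comp D (Fa ?u) (Fa ?v)) (Fa ?u) = Comp D (Ident D (Fo (Cod C x))) (Fa ?u)"
        using D vu dc by (simp add: F.Y.Comp_Ident' F.Y.Ident_Comp' flip: F.Y.Comp_assoc)
      have "Comp D (Fa ?u) (Fa ?v) = Ident D (Fo (Cod C x))"
        by (rule F.Y.iso_cancel_right[OF iso_u _ _ _ _ eq]) (use D dc F.Fo_Obj[OF obj(2)] in \<open>simp_all add: F.Y.cat_simps\<close>)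
      then show ?thesis
        by (simp add: xx)
    qed
    \<comment> \<open>With \<open>s = t \<cdot> x\<close> and \<open>f = g \<cdot> x\<close>, the
      span factors as \<open>[1, g] \<cdot> [x, x] \<cdot> [t, 1]\<close>; the functor erases the
      middle factor, and what remains is the image of \<open>[t, g]\<close>.\<close>
    have F_gen: "Fa (?a p) = Fa (?a q)" if pq: "(p, q) \<in> span_rel C S (\<lambda>x. x \<in> S_star C S)" for p q
    proof -
      obtain s f t g where e: "p = (s, f)" "q = (t, g)"
        by (cases p, cases q) blast
      obtain x where x: "span_mor C p q x" "x \<in> S_star C S" and sp: "p \<in> spans C S" "q \<in> spans C S"
        using pq by (auto simp: span_rel_def)
      have x': "x \<in> S" "x \<in> Arr C" "Cod C x = Dom C t" "t \<cdot> x = s" "g \<cdot> x = f"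
        using x assms by (auto simp: e span_mor_def)
      have m: "t \<in> S" "t \<in> Arr C" "g \<in> Arr C" "Dom C t = Dom C g"
        using sp by (auto simp: e spans_iff S_ArrD)
      have sp': "(t, Ident C (Dom C t)) \<in> spans C S" "(x, x) \<in> spans C S" "(t \<cdot> x, x) \<in> spans C S"
          "(Ident C (Dom C g), g) \<in> spans C S"
        using m x'(1-3) by (simp_all add: spans_iff cat_simps S_comp Ident_S)
      let ?t = "?a (t, Ident C (Dom C t))" and ?g = "?a (Ident C (Dom C g), g)"
      have arr: "?t \<in> Arr (Sect C S)" "?g \<in> Arr (Sect C S)" "?a (x, x) \<in> Arr (Sect C S)" "?a (t \<cdot> x, x) \<in> Arr (Sect C S)"
        using sp' by (simp_all add: a.cl_Arr)
      have dc: "Cod (Sect C S) ?t = Dom C t" "Dom (Sect C S) ?g = Dom C t"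
        "Dom (Sect C S) (?a (x, x)) = Dom C t" "Cod (Sect C S) (?a (t \<cdot> x, x)) = Dom C t"
        using sp' m x'(1-3) by (simp_all add: a.Dom_Y a.Cod_Y src_tgt cat_simps)
      have "Fa (?a (t \<cdot> x, x)) = Comp D (Fa (?a (x, x))) (Fa ?t)"
        using a.cl_Comp_right[OF sp'(2) m(1) x'(3)] F.Fa_Comp[OF arr(1,3)] dc by simp
      also have "\<dots> = Fa ?t"
        using F_idem[OF x(2)] x'(3) F.Fa_Arr[OF arr(1)] F.Fa_Cod[OF arr(1)] dc by (simp add: F.Y.Ident_Comp')
      finally have tx: "Fa (?a (t \<cdot> x, x)) = Fa ?t" .
      have "Fa (?a (t \<cdot> x, g \<cdot> x)) = Comp D (Fa ?g) (Fa (?a (t \<cdot> x, x)))"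
        using a.cl_Comp_left[OF sp'(3) m(3)] F.Fa_Comp[OF arr(4,2)] dc x'(3) m(4) by simp
      also have "\<dots> = Fa (?a (t, g))"
        using a.cl_factor[OF sp(2)[unfolded e]] F.Fa_Comp[OF arr(1,2)] dc by (simp add: tx)
      finally show ?thesis
        by (simp add: e x'(4,5))
    qed
    \<comment> \<open>The kernel of the functor on spans is an equivalence relation containing the
      generators, hence contains the closure \<open>sim_zstar\<close>.\<close>
    let ?K = "{(p, q). p \<in> spans C S \<and> q \<in> spans C S \<and> Fa (?a p) = Fa (?a q)}"
    have "sim_zstar C S \<subseteq> ?K"
      unfolding sim_zstar_def
    proof (rule equiv_closure_least)
      show "equiv (spans C S) ?K"
        by (auto simp: equiv_def refl_on_def sym_def trans_def)
      show "span_rel C S (\<lambda>x. x \<in> S_star C S) \<subseteq> ?K"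
        using F_gen by (auto dest: span_rel_src_tgt(1,2))
    qed
    then have kernel: "Fa (?a p) = Fa (?a q)" if "(p, q) \<in> sim_zstar C S" for p q
      using that by blast
    obtain Ga where Ga: "is_functor (Par C S) D Fo Ga" "\<And>p. p \<in> spans C S \<Longrightarrow> Ga (?z p) = Fa (?a p)"
    proof (rule z.functor_from_spans[of D Fo "\<lambda>p. Fa (?a p)"])
      show "category D"
        by (rule F.Y.category_axioms)
      show "Fo A \<in> Obj D" if "A \<in> Obj C" for A
        using F.Fo_Obj that by (simp add: a.Obj_Y)
      fix p
      assume p: "p \<in> spans C S"
      show "Fa (?a p) \<in> Arr D \<and> Dom D (Fa (?a p)) = Fo (src C p) \<and> Cod D (Fa (?a p)) = Fo (tgt C p)"
        using p by (simp add: F.Fa_Arr F.Fa_Dom F.Fa_Cod a.cl_Arr a.Dom_Y a.Cod_Y)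
      fix q r
      assume qr: "q \<in> spans C S" "r \<in> hcomp C q p"
      show "Fa (?a r) = Comp D (Fa (?a q)) (Fa (?a p))"
        using F.Fa_Comp[OF a.cl_Arr[OF p] a.cl_Arr[OF qr(1)]] hcomp_spans(4)[OF p qr] a.Comp_Y[OF p qr] p qr(1)
        by (simp add: a.Dom_Y a.Cod_Y)
    next
      show "Fa (?a (Ident C A, Ident C A)) = Ident D (Fo A)" if "A \<in> Obj C" for A
        using F.Fa_Ident[of A] that by (simp add: a.Obj_Y a.Ident_Y)
    qed (use kernel in blast)+
    have "factors_through (Sect C S) (Par C S) (\<lambda>A. A) (Sect_to_Par C S) D Fo Fa Fo Ga"
      unfolding factors_through_def using Ga by (auto simp: a.Arr_Y Q)
    \<comment> \<open>Uniqueness holds because \<open>Sect_to_Par\<close> is surjective: each class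
      \<open>?z p\<close> is the image of \<open>?a p\<close>.\<close>
    moreover have "(\<forall>A \<in> Obj (Par C S). Go' A = Fo A) \<and> (\<forall>f \<in> Arr (Par C S). Ga' f = Ga f)"
      if "factors_through (Sect C S) (Par C S) (\<lambda>A. A) (Sect_to_Par C S) D Fo Fa Go' Ga'" for Go' Ga'
    proof -
      have *: "\<forall>A \<in> Obj (Sect C S). Go' A = Fo A" "\<forall>f \<in> Arr (Sect C S). Ga' (Sect_to_Par C S f) = Fa f"
        using that by (simp_all add: factors_through_def)
      have "Ga' (?z p) = Ga (?z p)" if p: "p \<in> spans C S" for p
        using bspec[OF *(2) a.cl_Arr[OF p]] Ga(2)[OF p] Q[OF p] by simp
      then show ?thesis
        using *(1) by (auto simp: a.Obj_Y z.Obj_Y z.Arr_Y)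
    qed
    ultimately show ?thesis
      by blast
  qed
  then show ?thesis
    unfolding is_category_of_fractions_def using Q_functor iso by auto
qed

section \<open>\<open>Retr\<close> as a localization of \<open>C\<close>\<close>

lemma Retr_localization:
  assumes "S_star C S \<subseteq> S"
  shows "is_category_of_fractions TYPE('p) TYPE('b) C S (Retr C S) (\<lambda>A. A) (Phi_z C S)"
proof -
  interpret z: span_category C S "sim_z C S" "Retr C S" "span_class C S (sim_z C S)"
    by (rule span_category_Retr)
  let ?z = "span_class C S (sim_z C S)"
  have Phi: "Phi_z C S = (\<lambda>f. ?z (Ident C (Dom C f), f))"
    by (simp add: fun_eq_iff Phi_z_def)
  have Q_functor: "is_functor C (Retr C S) (\<lambda>A. A) (Phi_z C S)"
    unfolding Phi by (rule z.is_functor_unit)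
  have unit: "(Ident C (Dom C f), f) \<in> spans C S" if "f \<in> Arr C" for f
    using that by (simp add: spans_iff Ident_S cat_simps)
  \<comment> \<open>The hypothesis enters here: \<open>approx_a\<close> lies in
    \<open>sim_zstar\<close>, which \<open>S_star C S \<subseteq> S\<close> places inside
    \<open>sim_z\<close>. Thus \<open>[s, 1] \<cdot> [1, s]\<close> is an identity in
    \<open>Retr\<close> too.\<close>
  have approx: "approx_a C S \<subseteq> sim_z C S"
    using approx_a_sim_a sim_a_sim_zstar sim_zstar_sim_z[OF assms] by blast
  have iso: "is_iso (Retr C S) (Phi_z C S x)" if x: "x \<in> S" for x
  proof -
    have "((x, x), (Ident C (Cod C x), Ident C (Cod C x))) \<in> sim_z C S"
      using span_rel_Ident[of x "\<lambda>x. x \<in> S", OF x x] equiv_closure_incl unfolding sim_z_def by blast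
    then show ?thesis
      unfolding Phi by (rule z.is_iso_unit[OF approx x])
  qed
  have "\<exists>Go Ga. factors_through C (Retr C S) (\<lambda>A. A) (Phi_z C S) D Fo Fa Go Ga \<and>
      (\<forall>Go' Ga'. factors_through C (Retr C S) (\<lambda>A. A) (Phi_z C S) D Fo Fa Go' Ga' \<longrightarrow>
        (\<forall>A \<in> Obj (Retr C S). Go' A = Go A) \<and> (\<forall>f \<in> Arr (Retr C S). Ga' f = Ga f))"
    if F: "is_functor C D Fo Fa" and inv: "\<forall>x \<in> S. is_iso D (Fa x)"
    for D :: "('p, 'b) cat" and Fo Fa
  proof -
    interpret F: is_functor C D Fo Fa
      by (rule F)
    \<comment> \<open>The value on \<open>(s, f)\<close> is characterized by an equation rather than
      as \<open>Fa f\<close> composed with an inverse of \<open>Fa s\<close>; all later identities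
      are then proved by checking that equation and invoking uniqueness.\<close>
    define V where "V p y \<longleftrightarrow> y \<in> Arr D \<and> Dom D y = Fo (src C p) \<and> Cod D y = Fo (tgt C p) \<and>
      Comp D y (Fa (fst p)) = Fa (snd p)" for p y
    have V_unique: "y = y'" if "p \<in> spans C S" "V p y" "V p y'" for p y y'
    proof -
      have s: "fst p \<in> S" "fst p \<in> Arr C"
        using that(1) by (cases p; simp add: spans_iff S_ArrD)+
      have "is_iso D (Fa (fst p))"
        using inv s by blast
      then show ?thesis
        by (rule F.Y.iso_cancel_right) (use that(2,3) s in \<open>simp_all add: V_def src_def F.Fa_Cod\<close>)
    qed
    have V_exists: "\<exists>y. V p y" if p: "p \<in> spans C S" for p
    proof -
      obtain s f where e: "p = (s, f)"
        by (cases p) blast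
      have m: "s \<in> S" "s \<in> Arr C" "f \<in> Arr C" "Dom C s = Dom C f"
        using p by (auto simp: e spans_iff S_ArrD)
      have "is_iso D (Fa s)"
        using inv m(1) by blast
      then obtain i where i: "i \<in> Arr D" "Dom D i = Cod D (Fa s)" "Cod D i = Dom D (Fa s)"
          "Comp D i (Fa s) = Ident D (Dom D (Fa s))"
        by (rule F.Y.is_isoE)
      have "Comp D (Comp D (Fa f) i) (Fa s) = Fa f"
        using i m by (simp add: F.Fa_Arr F.Fa_Dom F.Fa_Cod F.Y.Comp_Ident' flip: F.Y.Comp_assoc)
      then have "V p (Comp D (Fa f) i)"
        using i(1-3) m by (simp add: V_def e src_tgt F.Fa_Arr F.Fa_Dom F.Fa_Cod F.Y.cat_simps)
      then show ?thesis
        by blast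
    qed
    define G where "G p = (SOME y. V p y)" for p
    have VG: "V p (G p)" if "p \<in> spans C S" for p
      unfolding G_def using V_exists[OF that] by (rule someI_ex)
    have G_eq: "G p = y" if "p \<in> spans C S" "V p y" for p y
      using V_unique VG that by blast
    \<comment> \<open>It suffices that \<open>G q\<close> solves the equation of \<open>p\<close>:
      as \<open>s = t \<cdot> x\<close> and \<open>f = g \<cdot> x\<close>, this is the equation of
      \<open>q\<close> composed with \<open>Fa x\<close>.\<close>
    have G_gen: "G p = G q" if pq: "(p, q) \<in> span_rel C S (\<lambda>x. x \<in> S)" for p q
    proof (rule G_eq)
      note st = span_rel_src_tgt[OF pq]
      show "p \<in> spans C S"
        by (rule st(1))
      obtain s f t g where e: "p = (s, f)" "q = (t, g)"
        by (cases p, cases q) blast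
      obtain x where x: "x \<in> Arr C" "Cod C x = Dom C t" "t \<cdot> x = s" "g \<cdot> x = f"
        using pq by (auto simp: span_rel_def span_mor_def e)
      have m: "t \<in> Arr C" "g \<in> Arr C" "Dom C t = Dom C g"
        using st(2) by (auto simp: e spans_iff S_ArrD)
      have y: "G q \<in> Arr D" "Dom D (G q) = Fo (Cod C t)" "Cod D (G q) = Fo (tgt C q)" "Comp D (G q) (Fa t) = Fa g"
        using VG[OF st(2)] by (simp_all add: V_def e src_tgt)
      have "Comp D (G q) (Fa s) = Comp D (Comp D (G q) (Fa t)) (Fa x)"
        using x(1,2) m y(1-3) by (simp add: F.Fa_Comp F.Fa_Arr F.Fa_Dom F.Fa_Cod F.Y.Comp_assoc flip: x(3))
      also have "\<dots> = Fa f"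
        using x(1,2) m by (simp add: y(4) F.Fa_Comp flip: x(4))
      finally show "V p (G q)"
        using y st(3,4) by (simp add: V_def e src_tgt)
    qed
    let ?K = "{(p, q). p \<in> spans C S \<and> q \<in> spans C S \<and> G p = G q}"
    have "sim_z C S \<subseteq> ?K"
      unfolding sim_z_def
    proof (rule equiv_closure_least)
      show "equiv (spans C S) ?K"
        by (auto simp: equiv_def refl_on_def sym_def trans_def)
      show "span_rel C S (\<lambda>x. x \<in> S) \<subseteq> ?K"
        using G_gen by (auto dest: span_rel_src_tgt(1,2))
    qed
    then have kernel: "G p = G q" if "(p, q) \<in> sim_z C S" for p q
      using that by blast
    have G_unit: "G (Ident C (Dom C f), f) = Fa f" if f: "f \<in> Arr C" for f
      using f by (intro G_eq unit)
        (simp_all add: V_def src_tgt F.Fa_Arr F.Fa_Dom F.Fa_Cod F.Fa_Ident F.Y.Comp_Ident' cat_simps)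
    obtain Ga where Ga: "is_functor (Retr C S) D Fo Ga" "\<And>p. p \<in> spans C S \<Longrightarrow> Ga (?z p) = G p"
    proof (rule z.functor_from_spans[of D Fo G])
      show "category D"
        by (rule F.Y.category_axioms)
      show "Fo A \<in> Obj D" if "A \<in> Obj C" for A
        using F.Fo_Obj that .
      show "G (Ident C A, Ident C A) = Ident D (Fo A)" if "A \<in> Obj C" for A
        using G_unit[of "Ident C A"] that by (simp add: cat_simps F.Fa_Ident)
      fix p
      assume p: "p \<in> spans C S"
      show "G p \<in> Arr D \<and> Dom D (G p) = Fo (src C p) \<and> Cod D (G p) = Fo (tgt C p)"
        using VG[OF p] by (simp add: V_def)
      fix q r
      assume q: "q \<in> spans C S" and r: "r \<in> hcomp C q p"
      obtain s f t g where e: "p = (s, f)" "q = (t, g)"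
        by (cases p, cases q) blast
      then obtain t' f' where re: "r = (s \<cdot> t', g \<cdot> f')" and P: "is_pullback C f t t' f'"
        using r by auto
      note d = pullbackD[OF P]
      have m: "s \<in> Arr C" "f \<in> Arr C" "Dom C s = Dom C f" "t \<in> Arr C" "g \<in> Arr C" "Dom C t = Dom C g"
        using p q by (auto simp: e spans_iff S_ArrD)
      have Gp: "G p \<in> Arr D" "Dom D (G p) = Fo (Cod C s)" "Cod D (G p) = Fo (Cod C f)" "Comp D (G p) (Fa s) = Fa f"
        using VG[OF p] by (simp_all add: V_def e src_tgt)
      have Gq: "G q \<in> Arr D" "Dom D (G q) = Fo (Cod C t)" "Cod D (G q) = Fo (Cod C g)" "Comp D (G q) (Fa t) = Fa g"
        using VG[OF q] by (simp_all add: V_def e src_tgt)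
      note Fs = F.Fa_Arr F.Fa_Dom F.Fa_Cod F.Y.cat_simps
      \<comment> \<open>The equations of \<open>p\<close> and \<open>q\<close> are applied in turn:
        that of \<open>p\<close> replaces \<open>G p\<close> after \<open>Fa s\<close> by
        \<open>Fa f\<close>, commutativity of the pullback square exchanges
        \<open>f \<cdot> t'\<close> for \<open>t \<cdot> f'\<close>, and that of \<open>q\<close>
        finishes. The result is the equation determining \<open>G r\<close>.\<close>
      have "Comp D (Comp D (G q) (G p)) (Fa (s \<cdot> t')) = Comp D (Comp D (G q) (Comp D (G p) (Fa s))) (Fa t')"
        using m Gp(1-3) Gq(1-3) d(1-8) by (simp add: Fs F.Fa_Comp F.Y.Comp_assoc)
      also have "\<dots> = Comp D (G q) (Fa (f \<cdot> t'))"
        using m Gq(1-3) d(1-8) by (simp add: Gp(4) Fs F.Fa_Comp F.Y.Comp_assoc)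
      also have "\<dots> = Comp D (Comp D (G q) (Fa t)) (Fa f')"
        using m Gq(1-3) d(1-8) by (simp add: d(9) Fs F.Fa_Comp F.Y.Comp_assoc)
      also have "\<dots> = Fa (g \<cdot> f')"
        using m d(1-8) by (simp add: Gq(4) F.Fa_Comp)
      finally have "V r (Comp D (G q) (G p))"
        using m Gp(1-3) Gq(1-3) d(1-8) by (simp add: V_def re src_tgt cat_simps F.Y.cat_simps)
      then show "G r = Comp D (G q) (G p)"
        by (rule G_eq[OF hcomp_spans(1)[OF p q r]])
    qed (use kernel in blast)+
    have "factors_through C (Retr C S) (\<lambda>A. A) (Phi_z C S) D Fo Fa Fo Ga"
      unfolding factors_through_def using Ga by (simp add: Phi unit G_unit)
    moreover have "(\<forall>A \<in> Obj (Retr C S). Go' A = Fo A) \<and> (\<forall>f \<in> Arr (Retr C S). Ga' f = Ga f)"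
      if F': "factors_through C (Retr C S) (\<lambda>A. A) (Phi_z C S) D Fo Fa Go' Ga'" for Go' Ga'
    proof -
      interpret F': is_functor "Retr C S" D Go' Ga'
        using F' by (simp add: factors_through_def)
      have Go': "Go' A = Fo A" if "A \<in> Obj C" for A
        using F' that by (simp add: factors_through_def)
      have Ga': "Ga' (?z (Ident C (Dom C f), f)) = Fa f" if "f \<in> Arr C" for f
        using F' that by (simp add: factors_through_def Phi)
      \<comment> \<open>Applying \<open>Ga'\<close> to \<open>[s, f] \<cdot> [1, s] = [1, f]\<close>
        shows that its value on \<open>[s, f]\<close> satisfies \<open>V\<close>, so it is the value
        already found.\<close>
      have "Ga' (?z p) = Ga (?z p)" if p: "p \<in> spans C S" for p
      proof -
        obtain s f where e: "p = (s, f)"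
          by (cases p) blast
        have m: "s \<in> Arr C" "f \<in> Arr C" "Dom C s = Dom C f"
          using p by (auto simp: e spans_iff S_ArrD)
        have arr: "?z (Ident C (Dom C s), s) \<in> Arr (Retr C S)" "?z p \<in> Arr (Retr C S)"
          using unit[OF m(1)] p by (simp_all add: z.cl_Arr)
        have "Comp D (Ga' (?z p)) (Ga' (?z (Ident C (Dom C s), s))) = Ga' (?z (Ident C (Dom C f), f))"
          using F'.Fa_Comp[OF arr] z.Comp_unit[OF approx p[unfolded e]] unit[OF m(1)] p
          by (simp add: e z.Dom_Y z.Cod_Y src_tgt)
        then have "Comp D (Ga' (?z p)) (Fa s) = Fa f"
          by (simp only: Ga'[OF m(1)] Ga'[OF m(2)])
        then have "V p (Ga' (?z p))"
          using F'.Fa_Arr[OF arr(2)] F'.Fa_Dom[OF arr(2)] F'.Fa_Cod[OF arr(2)] p m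
          by (simp add: V_def z.Dom_Y z.Cod_Y e src_tgt Go' cat_simps)
        then show ?thesis
          using G_eq[OF p] Ga(2)[OF p] by simp
      qed
      then show ?thesis
        using Go' by (auto simp: z.Obj_Y z.Arr_Y)
    qed
    ultimately show ?thesis
      by blast
  qed
  then show ?thesis
    unfolding is_category_of_fractions_def using Q_functor iso by auto
qed

end

text \<open>The first conjunct accounts for the special case of weak left cancellation. The type
  variables \<open>'p\<close> and \<open>'b\<close> stay free, so the universal properties cover
  test categories of arbitrary types.\<close>

theorem theorem5:
  fixes C :: "('o, 'a) cat" and S :: "'a set"
  assumes "stable_class C S"
  shows "(weakly_left_cancellable C S \<longrightarrow> S_star C S \<subseteq> S) \<and>
    (S_star C S \<subseteq> S \<longrightarrow>
       is_category_of_fractions TYPE('p) TYPE('b) (Sect C S) (Phi_a C S ` S_star C S)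
         (Par C S) (\<lambda>A. A) (Sect_to_Par C S) \<and>
       is_quotient_category (Sect C S) (Retr C S) (\<lambda>A. A) (Sect_to_Retr C S) \<and>
       is_category_of_fractions TYPE('p) TYPE('b) C S (Retr C S) (\<lambda>A. A) (Phi_z C S))"
proof -
  interpret stable_class C S
    by (rule assms)
  show ?thesis
    using S_star_subset Par_localization_of_Sect Retr_quotient_of_Sect Retr_localization by blast
qed

end
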